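(* Assume (A) $f$ and $g$ are continuous and $\rho$-weakly convex on $X$; (B) $f_{lb}=\inf_{x\in X}f(x)>-\infty$ and $g_{lb}=\inf_{x\in X}g(x)>-\infty$; (C) for any $x\in X$ one can compute $\zeta_f\in\partial f(x)$ and $\zeta_g\in\partial g(x)$ with $\|\zeta_f\|,\|\zeta_g\|\le M$; (D) $x_0\in X$ satisfies $g(x_0)\le 0$. Let $\hat\rho>\max\{\rho,1\}$, $\epsilon>0$ and $D=\sqrt{(-8g_{lb})/(\hat\rho-\rho)}$. Let $x_k$ be the iterates of the Proximally Guided Switching Subgradient Method started at $x_0$, let $(P_k)$ be its subproblems, and let $\hat x_{k+1}$ denote the optimal solution of $(P_k)$. (i) If $\tau=\frac{(\hat\rho-\rho)\epsilon^2}{4\hat\rho(2\hat\rho-\rho)}$ and $T_{inner}=\left\lceil\max\left\{\frac{96\hat\rho(2\hat\rho-\rho)(3M^2-2\hat\rho g_{lb})}{(\hat\rho-\rho)^2\epsilon^2},\sqrt{\frac{288\hat\rho^3(2\hat\rho-\rho)D^2}{(\hat\rho-\rho)^2\epsilon^2}}\right\}\right\rceil$, then $g(x_k)\le0$ at every iteration $k$ before $\hat x_{k+1}$ is an $\epsilon$-FJ point (i.e. for every $k\ge0$ such that there is no $j\le k$ for which $\hat x_{j+1}$ is an $\epsilon$-FJ point). (ii) Assume in addition (E): for some $\sigma>0$, $\sigma$-strong MFCQ is satisfied for every subproblem $(P_k)$, and let $B=\frac{M+\hat\rho D}{\sigma}$. If $\tau=\frac{(\hat\rho-\rho)\epsilon^2}{4(1+B)^2\hat\rho(2\hat\rho-\rho)}$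 and $T_{inner}=\left\lceil\max\left\{\frac{96(1+B)^2\hat\rho(2\hat\rho-\rho)(3M^2-2\hat\rho g_{lb})}{(\hat\rho-\rho)^2\epsilon^2},\sqrt{\frac{288(1+B)^2\hat\rho^3(2\hat\rho-\rho)D^2}{(\hat\rho-\rho)^2\epsilon^2}}\right\}\right\rceil$, then $g(x_k)\le0$ at every iteration $k$ before $\hat x_{k+1}$ is an $\epsilon$-KKT point (i.e. for every $k\ge0$ such that there is no $j\le k$ for which $\hat x_{j+1}$ is an $\epsilon$-KKT point).
   Context: Norms are Euclidean. $X\subseteq\mathbb{R}^d$ is closed and convex, $f,g:X\to\mathbb{R}$, $\rho\ge 0$ and $M>0$ are constants. $N_X(x)$ is the normal cone of $X$ at $x$, and $N_X^*(x)=\{v: v^Tn\ge0\ \forall n\in N_X(x)\}$ its dual cone; $\mathrm{dist}(x,S)=\min_{s\in S}\|x-s\|$. Subgradients: for convex $h$, $\partial h(x)=\{\zeta: h(x')\ge h(x)+\zeta^T(x'-x)\ \forall x'\in X\}$; for a possibly nonconvex $h$, $\partial h(x)$ is the Clarke subdifferential, the convex hull of all limits $\lim_i\nabla h(x_i)$ with $x_i\to x$, $x_i\in X$, $h$ differentiable at $x_i$. A function $h$ is $\rho$-weakly convex on $X$ if $h+\frac{\rho}{2}\|\cdot\|^2$ is convex on $X$; equivalently $h(x')\ge h(x)+\zeta^T(x'-x)-\frac{\rho}{2}\|x'-x\|^2$ for all $x,x'\in X$, $\zeta\in\partial h(x)$. Stationarity for $\min_{x\in X}f(x)$ s.t. $g(x)\le0$: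 $x\in X$ is an $\epsilon$-FJ point if $g(x)\le 0$ and there exist $\zeta_f\in\partial f(x)$, $\zeta_g\in\partial g(x)$, $\gamma_0,\gamma\ge0$ with $\gamma_0+\gamma=1$, $\mathrm{dist}(\gamma_0\zeta_f+\gamma\zeta_g,-N_X(x))\le\epsilon$ and $|\gamma g(x)|\le\epsilon^2$. It is an $\epsilon$-KKT point if $g(x)\le 0$ and there exist $\zeta_f\in\partial f(x)$, $\zeta_g\in\partial g(x)$, $\lambda\ge0$ with $\mathrm{dist}(\zeta_f+\lambda\zeta_g,-N_X(x))\le\epsilon$ and $|\lambda g(x)|\le\epsilon^2$. Switching subgradient method $SSM(\tau,T,z_0,\{\alpha_t\})$ for $\min_{z\in Z}F(z)$ s.t. $G(z)\le0$: start with $I=J=\emptyset$. For $t=0,\dots,T-1$: if $G(z_t)\le\tau$, set $z_{t+1}=\mathrm{proj}_Z(z_t-\alpha_t\zeta_{Ft})$ with $\zeta_{Ft}\in\partial F(z_t)$ and add $t$ to $I$; otherwise set $z_{t+1}=\mathrm{proj}_Z(z_t-\alpha_t\zeta_{Gt})$ with $\zeta_{Gt}\in\partial G(z_t)$ and add $t$ to $J$. Output $\bar z_T=\frac{\sum_{t\in I}(t+1)z_t}{\sum_{t\in I}(t+1)}$. Proximally Guided Switching Subgradient Method (inputs $\hat\rho>\max\{\rho,1\}$, $\tau>0$, $T_{inner}$, $x_0\in X$ with $g(x_0)\le0$): set $\alpha_t=\frac{2}{(\hat\rho-\rho)(t+2)+\frac{36\hat\rho^2}{(\hat\rho-\rho)(t+1)}}$;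 for $k=0,1,\dots$ let $x_{k+1}$ be the output of $SSM(\tau,T_{inner},x_k,\{\alpha_t\})$ applied, with $Z=X$, to the subproblem $(P_k)$ of minimizing $F_k(x)=f(x)+\frac{\hat\rho}{2}\|x-x_k\|^2$ over $x\in X$ subject to $G_k(x)=g(x)+\frac{\hat\rho}{2}\|x-x_k\|^2\le 0$. The subgradients used are $\zeta_f+\hat\rho(z-x_k)\in\partial F_k(z)$ and $\zeta_g+\hat\rho(z-x_k)\in\partial G_k(z)$ with $\zeta_f,\zeta_g$ the subgradients of $f,g$ at $z$ of norm at most $M$ from assumption (C). $\sigma$-strong MFCQ for $(P_k)$: for every $x\in X$ there is $v\in-N_X^*(x)$ with $\|v\|=1$ such that, if $G_k(x)=0$, then $\zeta^Tv\le-\sigma$ for all $\zeta\in\partial G_k(x)$. *)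

theory Defs
  imports "HOL-Analysis.Analysis"
begin

definition weakly_convex_on :: "real \<Rightarrow> 'a::euclidean_space set \<Rightarrow> ('a \<Rightarrow> real) \<Rightarrow> bool" where
  "weakly_convex_on \<rho> X h \<longleftrightarrow> convex_on X (\<lambda>x. h x + \<rho> / 2 * (norm x)\<^sup>2)"

definition normal_cone :: "'a::euclidean_space set \<Rightarrow> 'a \<Rightarrow> 'a set" where
  "normal_cone X x = {n. \<forall>y\<in>X. n \<bullet> (y - x) \<le> 0}"

definition dual_normal_cone :: "'a::euclidean_space set \<Rightarrow> 'a \<Rightarrow> 'a set" where
  "dual_normal_cone X x = {v. \<forall>n\<in>normal_cone X x. 0 \<le> v \<bullet> n}"

definition convex_subdiff :: "'a::euclidean_space set \<Rightarrow> ('a \<Rightarrow> real) \<Rightarrow> 'a \<Rightarrow> 'a set" where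
  "convex_subdiff X h x = {\<zeta>. \<forall>x'\<in>X. h x + \<zeta> \<bullet> (x' - x) \<le> h x'}"

text \<open>Functions on \<open>X\<close> are modelled by total functions whose values outside \<open>X\<close> must not
  matter. Hence differentiability at a point of \<open>X\<close> is differentiability within \<open>X\<close>; at interior
  points of \<open>X\<close> this is ordinary differentiability, with its unique gradient. If \<open>X\<close> has empty
  interior, every vector representing the derivative counts as a gradient.\<close>

definition clarke_subdiff :: "'a::euclidean_space set \<Rightarrow> ('a \<Rightarrow> real) \<Rightarrow> 'a \<Rightarrow> 'a set" where
  "clarke_subdiff X h x = convex hull
     {\<zeta>. \<exists>xs \<zeta>s. (\<forall>i::nat. xs i \<in> X \<and>
                  (h has_derivative (\<lambda>v. \<zeta>s i \<bullet> v)) (at (xs i) within X)) \<and>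
               xs \<longlonglongrightarrow> x \<and> \<zeta>s \<longlonglongrightarrow> \<zeta>}"

definition subdiff :: "'a::euclidean_space set \<Rightarrow> ('a \<Rightarrow> real) \<Rightarrow> 'a \<Rightarrow> 'a set" where
  "subdiff X h x = (if convex_on X h then convex_subdiff X h x else clarke_subdiff X h x)"

definition FJ_point ::
  "real \<Rightarrow> 'a::euclidean_space set \<Rightarrow> ('a \<Rightarrow> real) \<Rightarrow> ('a \<Rightarrow> real) \<Rightarrow> 'a \<Rightarrow> bool" where
  "FJ_point \<epsilon> X f g x \<longleftrightarrow> x \<in> X \<and> g x \<le> 0 \<and>
     (\<exists>\<zeta>f\<in>subdiff X f x. \<exists>\<zeta>g\<in>subdiff X g x. \<exists>\<gamma>0\<ge>0. \<exists>\<gamma>\<ge>0. \<gamma>0 + \<gamma> = 1 \<and>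
        infdist (\<gamma>0 *\<^sub>R \<zeta>f + \<gamma> *\<^sub>R \<zeta>g) (uminus ` normal_cone X x) \<le> \<epsilon> \<and>
        \<bar>\<gamma> * g x\<bar> \<le> \<epsilon>\<^sup>2)"

definition KKT_point ::
  "real \<Rightarrow> 'a::euclidean_space set \<Rightarrow> ('a \<Rightarrow> real) \<Rightarrow> ('a \<Rightarrow> real) \<Rightarrow> 'a \<Rightarrow> bool" where
  "KKT_point \<epsilon> X f g x \<longleftrightarrow> x \<in> X \<and> g x \<le> 0 \<and>
     (\<exists>\<zeta>f\<in>subdiff X f x. \<exists>\<zeta>g\<in>subdiff X g x. \<exists>\<mu>\<ge>0.
        infdist (\<zeta>f + \<mu> *\<^sub>R \<zeta>g) (uminus ` normal_cone X x) \<le> \<epsilon> \<and>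
        \<bar>\<mu> * g x\<bar> \<le> \<epsilon>\<^sup>2)"

definition optimal_solution ::
  "'a::euclidean_space set \<Rightarrow> ('a \<Rightarrow> real) \<Rightarrow> ('a \<Rightarrow> real) \<Rightarrow> 'a \<Rightarrow> bool" where
  "optimal_solution X F G y \<longleftrightarrow> is_arg_min F (\<lambda>x. x \<in> X \<and> G x \<le> 0) y"

text \<open>A run of the switching subgradient method: \<open>z\<close> are the iterates and \<open>\<zeta> t\<close> is the subgradient
  used at step \<open>t\<close>, of \<open>F\<close> if \<open>t \<in> I\<close> and of \<open>G\<close> if \<open>t \<in> J\<close>. The subgradients are chosen
  nondeterministically, so the method is a relation.\<close>

definition ssm_run ::
  "'a::euclidean_space set \<Rightarrow> ('a \<Rightarrow> real) \<Rightarrow> ('a \<Rightarrow> real) \<Rightarrow> real \<Rightarrow> nat \<Rightarrow> 'a \<Rightarrow> (nat \<Rightarrow> real)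
     \<Rightarrow> (nat \<Rightarrow> 'a) \<Rightarrow> (nat \<Rightarrow> 'a) \<Rightarrow> bool" where
  "ssm_run Z F G \<tau> T z0 \<alpha> z \<zeta> \<longleftrightarrow> z 0 = z0 \<and>
     (\<forall>t<T. \<zeta> t \<in> subdiff Z (if G (z t) \<le> \<tau> then F else G) (z t) \<and>
            z (Suc t) = closest_point Z (z t - \<alpha> t *\<^sub>R \<zeta> t))"

definition ssm_output ::
  "('a::euclidean_space \<Rightarrow> real) \<Rightarrow> real \<Rightarrow> nat \<Rightarrow> (nat \<Rightarrow> 'a) \<Rightarrow> 'a" where
  "ssm_output G \<tau> T z =
     (let I = {t. t < T \<and> G (z t) \<le> \<tau>}
      in (\<Sum>t\<in>I. real (t + 1) *\<^sub>R z t) /\<^sub>R (\<Sum>t\<in>I. real (t + 1)))"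

definition prox_fun ::
  "real \<Rightarrow> ('a::euclidean_space \<Rightarrow> real) \<Rightarrow> 'a \<Rightarrow> 'a \<Rightarrow> real" where
  "prox_fun \<rho>' h c x = h x + \<rho>' / 2 * (norm (x - c))\<^sup>2"

definition pgssm_step :: "real \<Rightarrow> real \<Rightarrow> nat \<Rightarrow> real" where
  "pgssm_step \<rho> \<rho>' t =
     2 / ((\<rho>' - \<rho>) * (real t + 2) + 36 * \<rho>'\<^sup>2 / ((\<rho>' - \<rho>) * (real t + 1)))"

text \<open>The choice of \<open>\<xi>\<close> says that the subgradients of the subproblem come from subgradients
  \<open>\<xi>\<close> of \<open>f\<close> or \<open>g\<close> of norm at most \<open>M\<close>.\<close>

definition pgssm_run ::
  "'a::euclidean_space set \<Rightarrow> ('a \<Rightarrow> real) \<Rightarrow> ('a \<Rightarrow> real) \<Rightarrow> real \<Rightarrow> real \<Rightarrow> real \<Rightarrow> real \<Rightarrow> nat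
     \<Rightarrow> 'a \<Rightarrow> (nat \<Rightarrow> 'a) \<Rightarrow> bool" where
  "pgssm_run X f g M \<rho> \<rho>' \<tau> T x0 x \<longleftrightarrow> x 0 = x0 \<and>
     (\<forall>k. \<exists>z \<zeta>.
        ssm_run X (prox_fun \<rho>' f (x k)) (prox_fun \<rho>' g (x k)) \<tau> T (x k) (pgssm_step \<rho> \<rho>') z \<zeta> \<and>
        (\<forall>t<T. \<exists>\<xi>. \<xi> \<in> subdiff X (if prox_fun \<rho>' g (x k) (z t) \<le> \<tau> then f else g) (z t) \<and>
               norm \<xi> \<le> M \<and> \<zeta> t = \<xi> + \<rho>' *\<^sub>R (z t - x k)) \<and>
        x (Suc k) = ssm_output (prox_fun \<rho>' g (x k)) \<tau> T z)"

definition strong_MFCQ ::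
  "real \<Rightarrow> 'a::euclidean_space set \<Rightarrow> ('a \<Rightarrow> real) \<Rightarrow> bool" where
  "strong_MFCQ \<sigma> X G \<longleftrightarrow>
     (\<forall>x\<in>X. \<exists>v\<in>uminus ` dual_normal_cone X x. norm v = 1 \<and>
        (G x = 0 \<longrightarrow> (\<forall>\<zeta>\<in>subdiff X G x. \<zeta> \<bullet> v \<le> - \<sigma>)))"

end

theory Submission
  imports Defs
begin

text \<open>One iteration is compared with the exact solution \<open>y\<close> of its subproblem, which is strongly convex
  because \<open>\<rho>' > \<rho>\<close>.

  If \<open>y\<close> is near the centre \<open>x k\<close>, then \<open>y\<close> is approximately stationary for the original problem: the
  two Fritz John systems differ by the gradient \<open>\<rho>' *\<^sub>R (y - x k)\<close> of the proximal term, and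
  complementary slackness by a multiple of the squared distance (\<open>near_prox_solution_FJ\<close>). Under the
  constraint qualification the multiplier of the constraint is at most \<open>B\<close> times that of the
  objective, and the same argument gives KKT points with accuracy worse by the factor \<open>1 + B\<close> (\<open>near_prox_solution_KKT\<close>). So before a stationary solution occurs, \<open>y\<close> is
  far from \<open>x k\<close>.

  The inner method returns a point whose objective and constraint are within \<open>\<tau>\<close> of optimality and
  feasibility (\<open>ssm_output_accuracy\<close>). By the strong convexity of the Lagrangian such a point is near
  \<open>y\<close> (\<open>near_prox_solution_if_accurate\<close>), hence far from \<open>x k\<close>. Its proximal term is then at least
  \<open>\<tau>\<close>; as \<open>g\<close> plus the proximal term is at most \<open>\<tau>\<close>, \<open>g\<close> is nonpositive
  (\<open>feasible_if_solution_far\<close>).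

  The delicate point is the Fritz John theorem itself: for nonconvex functions it must produce
  Clarke subgradients, defined by limits of gradients, and the subgradient of \<open>f\<close> must have norm at most \<open>M\<close>.
  It rests on two facts. Gradients of norm at most \<open>M\<close> exist at a dense set of points of the relative
  interior (\<open>differentiability_points_dense\<close>), so that their limits at \<open>x\<close> dominate the directional
  derivatives there (\<open>limit_subgradient_in_direction\<close>). And a compact convex set of subgradients
  that contains one with nonnegative slope in each direction contains one whose negative is normal
  to \<open>X\<close> (\<open>compact_convex_meets_polar_cone\<close>).\<close>

section \<open>Weakly convex functions and their subgradients\<close>

lemma norm_convex_combination_power2:
  fixes x y c :: "'a::real_inner"
  shows "(norm ((1 - t) *\<^sub>R x + t *\<^sub>R y - c))\<^sup>2
    = (1 - t) * (norm (x - c))\<^sup>2 + t * (norm (y - c))\<^sup>2 - t * (1 - t) * (norm (y - x))\<^sup>2"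
  unfolding power2_norm_eq_inner
  by (simp add: inner_diff_left inner_diff_right inner_add_left inner_add_right inner_commute)
     (simp add: algebra_simps)

lemma weakly_convex_on_segment:
  assumes "weakly_convex_on \<rho> X h" "x \<in> X" "y \<in> X" "0 \<le> t" "t \<le> 1"
  shows "h ((1 - t) *\<^sub>R x + t *\<^sub>R y)
    \<le> (1 - t) * h x + t * h y + \<rho> / 2 * (t * (1 - t) * (norm (y - x))\<^sup>2)"
proof -
  define w where "w = (1 - t) *\<^sub>R x + t *\<^sub>R y"
  have "h w + \<rho> / 2 * (norm w)\<^sup>2
      \<le> (1 - t) * (h x + \<rho> / 2 * (norm x)\<^sup>2) + t * (h y + \<rho> / 2 * (norm y)\<^sup>2)"
    using assms unfolding weakly_convex_on_def w_def by (intro convex_onD) auto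
  moreover have "(norm w)\<^sup>2 = (1 - t) * (norm x)\<^sup>2 + t * (norm y)\<^sup>2 - t * (1 - t) * (norm (y - x))\<^sup>2"
    using norm_convex_combination_power2[of t x y 0] by (simp add: w_def)
  ultimately show ?thesis
    unfolding w_def[symmetric] by (simp add: field_simps)
qed

text \<open>The curvature of the proximal term compensates the concavity allowed to \<open>h\<close>.\<close>

lemma prox_fun_convex_on:
  assumes "weakly_convex_on \<rho> X h" "convex X" "\<rho> \<le> \<rho>'"
  shows "convex_on X (prox_fun \<rho>' h c)"
proof (rule convex_onI)
  fix t :: real and x y assume t: "0 < t" "t < 1" and xy: "x \<in> X" "y \<in> X"
  define w where "w = (1 - t) *\<^sub>R x + t *\<^sub>R y"
  define q where "q = t * (1 - t) * (norm (y - x))\<^sup>2"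
  have "0 \<le> (\<rho>' - \<rho>) / 2 * q"
    using t assms(3) by (simp add: q_def)
  moreover have "h w \<le> (1 - t) * h x + t * h y + \<rho> / 2 * q"
    unfolding w_def q_def using weakly_convex_on_segment[OF assms(1) xy] t by simp
  moreover have q: "(norm (w - c))\<^sup>2 = (1 - t) * (norm (x - c))\<^sup>2 + t * (norm (y - c))\<^sup>2 - q"
    unfolding w_def q_def by (rule norm_convex_combination_power2)
  ultimately show "prox_fun \<rho>' h c ((1 - t) *\<^sub>R x + t *\<^sub>R y)
      \<le> (1 - t) * prox_fun \<rho>' h c x + t * prox_fun \<rho>' h c y"
    unfolding prox_fun_def w_def[symmetric] q by (simp add: field_simps)
qed fact

text \<open>These are the subgradients at \<open>x\<close> of the convex function \<open>y \<mapsto> h y + \<rho> / 2 * (norm (y - x))\<^sup>2\<close>. The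
  set contains the convex as well as the Clarke subgradients of \<open>h\<close>, which gives both cases of
  \<open>subdiff\<close> the same quantitative inequality.\<close>

definition weak_subdiff :: "real \<Rightarrow> 'a::euclidean_space set \<Rightarrow> ('a \<Rightarrow> real) \<Rightarrow> 'a \<Rightarrow> 'a set" where
  "weak_subdiff \<rho> X h x
    = {\<zeta>. \<forall>y\<in>X. h x + \<zeta> \<bullet> (y - x) - \<rho> / 2 * (norm (y - x))\<^sup>2 \<le> h y}"

lemma weak_subdiffD:
  "\<zeta> \<in> weak_subdiff \<rho> X h x \<Longrightarrow> y \<in> X
    \<Longrightarrow> h x + \<zeta> \<bullet> (y - x) - \<rho> / 2 * (norm (y - x))\<^sup>2 \<le> h y"
  unfolding weak_subdiff_def by blast

lemma convex_weak_subdiff: "convex (weak_subdiff \<rho> X h x)"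
proof -
  have "weak_subdiff \<rho> X h x
      = (\<Inter>y\<in>X. {\<zeta>. (y - x) \<bullet> \<zeta> \<le> h y - h x + \<rho> / 2 * (norm (y - x))\<^sup>2})"
    unfolding weak_subdiff_def by (auto simp: inner_commute algebra_simps)
  then show ?thesis
    by (simp add: convex_INT convex_halfspace_le)
qed

lemma weak_subdiff_limit:
  assumes "continuous_on X h" "x \<in> X"
    and "\<And>i. xs i \<in> X" "\<And>i. \<zeta>s i \<in> weak_subdiff \<rho> X h (xs i)"
    and "xs \<longlonglongrightarrow> x" "\<zeta>s \<longlonglongrightarrow> \<zeta>"
  shows "\<zeta> \<in> weak_subdiff \<rho> X h x"
  unfolding weak_subdiff_def
proof clarify
  fix y assume y: "y \<in> X"
  have h: "(\<lambda>i. h (xs i)) \<longlonglongrightarrow> h x"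
    by (rule continuous_on_tendsto_compose[OF assms(1,5,2)]) (simp add: assms(3))
  have "(\<lambda>i. h (xs i) + \<zeta>s i \<bullet> (y - xs i) - \<rho> / 2 * (norm (y - xs i))\<^sup>2)
      \<longlonglongrightarrow> h x + \<zeta> \<bullet> (y - x) - \<rho> / 2 * (norm (y - x))\<^sup>2"
    by (intro tendsto_intros h assms)
  then show "h x + \<zeta> \<bullet> (y - x) - \<rho> / 2 * (norm (y - x))\<^sup>2 \<le> h y"
    by (rule LIMSEQ_le_const2) (use weak_subdiffD[OF assms(4) y] in auto)
qed

lemma gradient_in_weak_subdiff:
  assumes wc: "weakly_convex_on \<rho> X h" and "convex X" and "\<rho> \<ge> 0" and z: "z \<in> X"
    and der: "(h has_derivative (\<lambda>v. \<zeta> \<bullet> v)) (at z within X)"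
  shows "\<zeta> \<in> weak_subdiff \<rho> X h z"
  unfolding weak_subdiff_def
proof clarify
  fix y assume y: "y \<in> X"
  define d where "d = y - z"
  have "\<zeta> \<bullet> d \<le> h y - h z + \<rho> / 2 * (norm d)\<^sup>2 + e" if e: "e > 0" for e
  proof -
    define e' where "e' = e / (norm d + 1)"
    have e': "e' > 0" "e' * norm d \<le> e"
      using e by (auto simp: e'_def field_simps add_pos_nonneg add_nonneg_pos)
    from der e'(1) obtain \<delta> where "\<delta> > 0"
      and \<delta>: "\<And>w. w \<in> X \<Longrightarrow> norm (w - z) < \<delta> \<Longrightarrow> \<bar>h w - h z - \<zeta> \<bullet> (w - z)\<bar> \<le> e' * norm (w - z)"
      unfolding has_derivative_within_alt by auto
    define t where "t = min 1 (\<delta> / (2 * (norm d + 1)))"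
    have t: "0 < t" "t \<le> 1" using \<open>\<delta> > 0\<close> by (auto simp: t_def add_nonneg_pos)
    have "t * norm d < \<delta>"
    proof -
      have "t * norm d \<le> \<delta> / (2 * (norm d + 1)) * norm d"
        by (intro mult_right_mono) (auto simp: t_def)
      also have "\<dots> < \<delta>" using \<open>\<delta> > 0\<close>
        by (simp add: divide_simps add_nonneg_pos)
      finally show ?thesis .
    qed
    define w where "w = (1 - t) *\<^sub>R z + t *\<^sub>R y"
    have wz: "w - z = t *\<^sub>R d" by (simp add: w_def d_def algebra_simps)
    have w: "w \<in> X" unfolding w_def using assms y t by (simp add: convexD_alt)
    have "\<zeta> \<bullet> (w - z) \<le> h w - h z + e' * norm (w - z)"
      using \<delta>[OF w] wz \<open>t * norm d < \<delta>\<close> t by simp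
    moreover have "h w \<le> (1 - t) * h z + t * h y + \<rho> / 2 * (t * (1 - t) * (norm d)\<^sup>2)"
      unfolding w_def d_def using weakly_convex_on_segment[OF wc z y] t by simp
    moreover have "\<rho> / 2 * (t * (1 - t) * (norm d)\<^sup>2) \<le> t * (\<rho> / 2 * (norm d)\<^sup>2)"
      using t \<open>\<rho> \<ge> 0\<close> by (simp add: field_simps)
    ultimately have "t * (\<zeta> \<bullet> d) \<le> t * (h y - h z + \<rho> / 2 * (norm d)\<^sup>2 + e' * norm d)"
      using t by (simp add: wz algebra_simps)
    then show ?thesis using t e'(2) by simp
  qed
  then have "\<zeta> \<bullet> d \<le> h y - h z + \<rho> / 2 * (norm d)\<^sup>2"
    by (rule field_le_epsilon)
  then show "h z + \<zeta> \<bullet> (y - z) - \<rho> / 2 * (norm (y - z))\<^sup>2 \<le> h y"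
    by (simp add: d_def)
qed

text \<open>In the Clarke case the inequality holds for gradients by convexity along segments, for their
  limits by continuity, and for convex combinations because it is affine in \<open>\<zeta>\<close>.\<close>

lemma subdiff_subset_weak_subdiff:
  assumes "weakly_convex_on \<rho> X h" "convex X" "\<rho> \<ge> 0" "continuous_on X h" "x \<in> X"
  shows "subdiff X h x \<subseteq> weak_subdiff \<rho> X h x"
proof (cases "convex_on X h")
  case True
  show ?thesis
  proof
    fix \<zeta> assume "\<zeta> \<in> subdiff X h x"
    then have "h x + \<zeta> \<bullet> (y - x) \<le> h y" if "y \<in> X" for y
      using True that by (auto simp: subdiff_def convex_subdiff_def)
    moreover have "0 \<le> \<rho> / 2 * (norm (y - x))\<^sup>2" for y using \<open>\<rho> \<ge> 0\<close> by simp
    ultimately show "\<zeta> \<in> weak_subdiff \<rho> X h x"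
      unfolding weak_subdiff_def by (smt (verit) mem_Collect_eq)
  qed
next
  case False
  then show ?thesis
    unfolding subdiff_def clarke_subdiff_def
    using weak_subdiff_limit[OF assms(4,5)] gradient_in_weak_subdiff[OF assms(1-3)]
    by (simp, intro hull_minimal convex_weak_subdiff) (smt (verit) mem_Collect_eq subsetI)
qed

lemma prox_fun_growth:
  assumes "\<zeta> \<in> weak_subdiff \<rho> X h z" "y \<in> X"
  shows "prox_fun \<rho>' h c z + (\<zeta> + \<rho>' *\<^sub>R (z - c)) \<bullet> (y - z) + (\<rho>' - \<rho>) / 2 * (norm (y - z))\<^sup>2
    \<le> prox_fun \<rho>' h c y"
proof -
  have "(norm (y - c))\<^sup>2 = (norm (z - c))\<^sup>2 + 2 * ((z - c) \<bullet> (y - z)) + (norm (y - z))\<^sup>2"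
    unfolding power2_norm_eq_inner by (simp add: inner_diff_left inner_diff_right inner_commute)
  then have q: "\<rho>' / 2 * (norm (y - c))\<^sup>2
     = \<rho>' / 2 * (norm (z - c))\<^sup>2 + \<rho>' * ((z - c) \<bullet> (y - z)) + \<rho>' / 2 * (norm (y - z))\<^sup>2"
    by (simp add: distrib_left)
  with weak_subdiffD[OF assms] show ?thesis
    unfolding prox_fun_def q by (simp add: inner_add_left diff_divide_distrib left_diff_distrib)
qed

section \<open>Existence of limiting gradients in prescribed directions\<close>

lemma weak_subdiff_lipschitz:
  assumes "\<zeta> \<in> weak_subdiff \<rho> X h p" "norm \<zeta> \<le> M" "w \<in> X"
  shows "h p \<le> h w + M * norm (w - p) + \<rho> / 2 * (norm (w - p))\<^sup>2"
proof -
  have "\<bar>\<zeta> \<bullet> (w - p)\<bar> \<le> M * norm (w - p)"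
    using Cauchy_Schwarz_ineq2[of \<zeta> "w - p"] assms(2)
    by (meson mult_right_mono norm_ge_zero order_trans)
  with weak_subdiffD[OF assms(1,3)] show ?thesis by linarith
qed

text \<open>In the relative interior of \<open>X\<close> a weakly convex function is differentiable wherever a paraboloid
  touches its graph from above, since the subgradient paraboloid touches it there from below. Maximising
  \<open>h w - c * norm (w - p)\<^sup>2\<close> with \<open>c\<close> large gives such a point near \<open>p\<close>, which replaces the
  almost-everywhere differentiability of convex functions. The gradient found is a given subgradient
  of norm at most \<open>M\<close>, so it inherits this bound.\<close>

lemma differentiability_points_dense:
  fixes X :: "'a::euclidean_space set"
  assumes X: "closed X" "convex X" and "\<rho> \<ge> 0" and "M > 0" and cont: "continuous_on X h"
    and bdd: "\<And>x. x \<in> X \<Longrightarrow> \<exists>\<zeta>\<in>weak_subdiff \<rho> X h x. norm \<zeta> \<le> M"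
    and p: "p \<in> rel_interior X" and "\<delta> > 0"
  shows "\<exists>w \<zeta>. w \<in> X \<and> norm (w - p) \<le> \<delta> \<and> norm \<zeta> \<le> M
    \<and> (h has_derivative (\<lambda>v. \<zeta> \<bullet> v)) (at w within X)"
proof -
  from p obtain r where r: "r > 0" "ball p r \<inter> affine hull X \<subseteq> X" and pX: "p \<in> X"
    unfolding mem_rel_interior_ball by blast
  define \<eta> where "\<eta> = min \<delta> (r / 2)"
  have \<eta>: "\<eta> > 0" "\<eta> \<le> \<delta>" "\<eta> < r" using \<open>\<delta> > 0\<close> r by (auto simp: \<eta>_def)
  \<comment> \<open>Large enough for the maximiser to lie strictly inside the ball of radius \<open>\<eta>\<close>.\<close>
  define c where "c = \<rho> / 2 + 2 * M / \<eta>"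
  have "c > 0" using \<open>\<rho> \<ge> 0\<close> \<open>M > 0\<close> \<eta> by (auto simp: c_def intro: add_nonneg_pos)
  have "compact (X \<inter> cball p \<eta>)" using X by (simp add: closed_Int_compact)
  moreover have "continuous_on (X \<inter> cball p \<eta>) (\<lambda>w. h w - c * (norm (w - p))\<^sup>2)"
    by (intro continuous_intros continuous_on_subset[OF cont]) auto
  moreover have "X \<inter> cball p \<eta> \<noteq> {}" using pX \<eta> by auto
  ultimately obtain w where "w \<in> X \<inter> cball p \<eta>"
    and "\<forall>y\<in>X \<inter> cball p \<eta>. h y - c * (norm (y - p))\<^sup>2 \<le> h w - c * (norm (w - p))\<^sup>2"
    using continuous_attains_sup[of "X \<inter> cball p \<eta>" "\<lambda>w. h w - c * (norm (w - p))\<^sup>2"]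
    by blast
  then have w: "w \<in> X" "norm (w - p) \<le> \<eta>"
    and max: "\<And>y. y \<in> X \<Longrightarrow> norm (y - p) \<le> \<eta> \<Longrightarrow> h y - c * (norm (y - p))\<^sup>2 \<le> h w - c * (norm (w - p))\<^sup>2"
    by (auto simp: dist_norm norm_minus_commute)
  from bdd[OF w(1)] obtain \<zeta> where \<zeta>: "\<zeta> \<in> weak_subdiff \<rho> X h w" "norm \<zeta> \<le> M" by blast
  have near: "norm (w - p) < \<eta>"
  proof (rule ccontr)
    assume "\<not> ?thesis"
    with w have eq: "norm (w - p) = \<eta>" by simp
    have "c * \<eta>\<^sup>2 \<le> h w - h p" using max[OF pX] \<eta> eq by simp
    also have "\<dots> \<le> M * \<eta> + \<rho> / 2 * \<eta>\<^sup>2"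
      using weak_subdiff_lipschitz[OF \<zeta> pX] eq by (simp add: norm_minus_commute)
    finally have "c * \<eta>\<^sup>2 \<le> M * \<eta> + \<rho> / 2 * \<eta>\<^sup>2" .
    moreover have "c * \<eta>\<^sup>2 = \<rho> / 2 * \<eta>\<^sup>2 + 2 * (M * \<eta>)"
      using \<eta> by (simp add: c_def power2_eq_square field_simps)
    moreover have "M * \<eta> > 0" using \<open>M > 0\<close> \<eta> by simp
    ultimately show False by linarith
  qed
  define u where "u = (2 * c) *\<^sub>R (w - p)"
  have upper: "h y \<le> h w + u \<bullet> (y - w) + c * (norm (y - w))\<^sup>2"
    if "y \<in> X" "norm (y - w) \<le> \<eta> - norm (w - p)" for y
  proof -
    have "norm (y - p) \<le> \<eta>" using that norm_triangle_ineq[of "y - w" "w - p"] by simp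
    moreover have "(norm (y - p))\<^sup>2 = (norm (w - p))\<^sup>2 + 2 * ((w - p) \<bullet> (y - w)) + (norm (y - w))\<^sup>2"
      unfolding power2_norm_eq_inner by (simp add: inner_diff_left inner_diff_right inner_commute)
    then have "c * (norm (y - p))\<^sup>2 = c * (norm (w - p))\<^sup>2 + u \<bullet> (y - w) + c * (norm (y - w))\<^sup>2"
      by (simp add: u_def distrib_left)
    ultimately show ?thesis using max[OF that(1)] by linarith
  qed
  have le: "(\<zeta> - u) \<bullet> v \<le> 0" if seg: "\<And>s. 0 < s \<Longrightarrow> s \<le> \<beta> \<Longrightarrow> w + s *\<^sub>R v \<in> X" and "\<beta> > 0" for v \<beta>
  proof -
    have "(\<zeta> - u) \<bullet> v \<le> 0 + e" if "e > 0" for e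
    proof -
      define K where "K = (c + \<rho> / 2) * (norm v)\<^sup>2 + 1"
      have K: "K > 0" using \<open>c > 0\<close> \<open>\<rho> \<ge> 0\<close> by (simp add: K_def add_nonneg_pos)
      define s where "s = min \<beta> (min (e / K) ((\<eta> - norm (w - p)) / (norm v + 1)))"
      have s: "0 < s" "s \<le> \<beta>" "s \<le> e / K" "s \<le> (\<eta> - norm (w - p)) / (norm v + 1)"
        using \<open>\<beta> > 0\<close> \<open>e > 0\<close> K near by (auto simp: s_def add_nonneg_pos)
      have "s * norm v \<le> s * (norm v + 1)" using s by simp
      also have "\<dots> \<le> \<eta> - norm (w - p)"
        using s(4) by (simp add: pos_le_divide_eq add_nonneg_pos)
      finally have "norm (w + s *\<^sub>R v - w) \<le> \<eta> - norm (w - p)" using s by simp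
      from upper[OF seg[OF s(1,2)] this] weak_subdiffD[OF \<zeta>(1) seg[OF s(1,2)]]
      have "s * ((\<zeta> - u) \<bullet> v) \<le> (c + \<rho> / 2) * (norm (s *\<^sub>R v))\<^sup>2"
        by (simp add: algebra_simps)
      also have "\<dots> \<le> s * (s * K)"
        using s by (simp add: K_def power_mult_distrib power2_eq_square algebra_simps)
      finally have "(\<zeta> - u) \<bullet> v \<le> s * K" using s by simp
      also have "\<dots> \<le> e" using s(3) K by (simp add: pos_le_divide_eq)
      finally show ?thesis by simp
    qed
    then show ?thesis by (rule field_le_epsilon)
  qed
  \<comment> \<open>Near the point \<open>p\<close> of the relative interior both \<open>y - w\<close> and its opposite are feasible
    directions at \<open>w\<close>, so the slopes of the two paraboloids agree.\<close>
  have slope: "\<zeta> \<bullet> (y - w) = u \<bullet> (y - w)" if y: "y \<in> X" for y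
  proof -
    have "w + s *\<^sub>R (y - w) \<in> X" if "0 < s" "s \<le> 1" for s
    proof -
      have "w + s *\<^sub>R (y - w) = (1 - s) *\<^sub>R w + s *\<^sub>R y" by (simp add: algebra_simps)
      then show ?thesis using convexD_alt[OF X(2) w(1) y] that by simp
    qed
    then have "(\<zeta> - u) \<bullet> (y - w) \<le> 0" by (rule le[where \<beta> = 1]) simp_all
    moreover have "w + s *\<^sub>R (w - y) \<in> X" if "0 < s" "s \<le> (r - \<eta>) / (norm (w - y) + 1)" for s
    proof -
      have "s * norm (w - y) \<le> s * (norm (w - y) + 1)" using that by simp
      also have "\<dots> \<le> r - \<eta>" using that(2) by (simp add: pos_le_divide_eq add_nonneg_pos)
      finally have "norm (w + s *\<^sub>R (w - y) - p) < r"
        using near norm_triangle_ineq[of "w - p" "s *\<^sub>R (w - y)"] that(1)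
        by (simp add: add_diff_eq[symmetric] diff_add_eq)
      then have "w + s *\<^sub>R (w - y) \<in> ball p r" by (simp add: dist_norm norm_minus_commute)
      moreover have "w + s *\<^sub>R (w - y) = (1 + s) *\<^sub>R w + (- s) *\<^sub>R y" by (simp add: algebra_simps)
      then have "w + s *\<^sub>R (w - y) \<in> affine hull X"
        using mem_affine[OF affine_affine_hull hull_inc[OF w(1)] hull_inc[OF y], of "1 + s" "- s"]
        by simp
      ultimately show ?thesis using r(2) by blast
    qed
    then have "(\<zeta> - u) \<bullet> (w - y) \<le> 0"
      by (rule le[where \<beta> = "(r - \<eta>) / (norm (w - y) + 1)"]) (use \<eta> in \<open>simp_all add: add_nonneg_pos\<close>)
    ultimately show ?thesis by (simp add: inner_diff_left inner_diff_right)
  qed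
  have "(h has_derivative (\<lambda>v. \<zeta> \<bullet> v)) (at w within X)"
    unfolding has_derivative_within_alt
  proof (intro conjI allI impI)
    show "bounded_linear ((\<bullet>) \<zeta>)" by (rule bounded_linear_inner_right)
    fix e :: real assume "e > 0"
    define K where "K = c + \<rho> / 2"
    have K: "K > 0" using \<open>c > 0\<close> \<open>\<rho> \<ge> 0\<close> by (simp add: K_def)
    define \<mu> where "\<mu> = min (e / K) (\<eta> - norm (w - p))"
    have "\<mu> > 0" using \<open>e > 0\<close> K near by (simp add: \<mu>_def)
    moreover have "norm (h y - h w - \<zeta> \<bullet> (y - w)) \<le> e * norm (y - w)"
      if y: "y \<in> X" "norm (y - w) < \<mu>" for y
    proof -
      have q: "0 \<le> c * (norm (y - w))\<^sup>2" "0 \<le> \<rho> / 2 * (norm (y - w))\<^sup>2"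
        using \<open>c > 0\<close> \<open>\<rho> \<ge> 0\<close> by simp_all
      have "h y \<le> h w + u \<bullet> (y - w) + c * (norm (y - w))\<^sup>2"
        using y by (intro upper) (auto simp: \<mu>_def)
      then have "\<bar>h y - h w - \<zeta> \<bullet> (y - w)\<bar> \<le> c * (norm (y - w))\<^sup>2 + \<rho> / 2 * (norm (y - w))\<^sup>2"
        using weak_subdiffD[OF \<zeta>(1) y(1)] slope[OF y(1)] q unfolding abs_le_iff by linarith
      also have "\<dots> = (K * norm (y - w)) * norm (y - w)"
        by (simp add: K_def power2_eq_square algebra_simps)
      also have "\<dots> \<le> e * norm (y - w)"
        using y(2) K by (intro mult_right_mono) (auto simp: \<mu>_def pos_less_divide_eq mult.commute)
      finally show ?thesis by simp
    qed
    ultimately show "\<exists>d>0. \<forall>y\<in>X. norm (y - w) < d \<longrightarrow> norm (h y - h w - \<zeta> \<bullet> (y - w)) \<le> e * norm (y - w)"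
      by blast
  qed
  with w \<zeta> \<eta> show ?thesis by (intro exI[of _ w] exI[of _ \<zeta>]) auto
qed

text \<open>At a point \<open>w\<close> close to \<open>x + t *\<^sub>R (y - x)\<close>, the subgradient inequality evaluated at \<open>x\<close> says
  that the slope of the subgradient towards \<open>y\<close> is at least the difference quotient, up to an error
  of order \<open>t\<close>. Boundedness gives a limit as \<open>t\<close> tends to \<open>0\<close>. The graph \<open>\<Gamma>\<close> stands for convex
  subgradients as well as for gradients.\<close>

lemma limit_subgradient_in_direction:
  fixes X :: "'a::euclidean_space set" and \<Gamma> :: "('a \<times> 'a) set"
  assumes "convex X" and "\<rho> \<ge> 0" and "M \<ge> 0" and x: "x \<in> X" and y: "y \<in> rel_interior X"
    and bdd: "\<And>p. p \<in> X \<Longrightarrow> \<exists>\<zeta>\<in>weak_subdiff \<rho> X h p. norm \<zeta> \<le> M"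
    and \<Gamma>: "\<And>w \<zeta>. (w, \<zeta>) \<in> \<Gamma> \<Longrightarrow> w \<in> X \<and> \<zeta> \<in> weak_subdiff \<rho> X h w \<and> norm \<zeta> \<le> M"
    and dense: "\<And>p \<delta>. p \<in> rel_interior X \<Longrightarrow> \<delta> > 0 \<Longrightarrow> \<exists>w \<zeta>. (w, \<zeta>) \<in> \<Gamma> \<and> norm (w - p) \<le> \<delta>"
    and growth: "\<And>t. 0 < t \<Longrightarrow> t \<le> 1 \<Longrightarrow> h x + t * a - L * t\<^sup>2 \<le> h (x + t *\<^sub>R (y - x))"
  shows "\<exists>\<zeta>. (x, \<zeta>) \<in> closure \<Gamma> \<and> a \<le> \<zeta> \<bullet> (y - x)"
proof -
  define v where "v = y - x"
  define C where "C = L + 2 * M + \<rho> / 2 + \<rho> / 2 * (norm v + 1)\<^sup>2"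
  have step: "\<exists>w \<zeta>. (w, \<zeta>) \<in> \<Gamma> \<and> norm (w - x) \<le> t * (norm v + 1) \<and> a - C * t \<le> \<zeta> \<bullet> v"
    if t: "0 < t" "t \<le> 1" for t
  proof -
    define p where "p = x + t *\<^sub>R v"
    have "p \<in> rel_interior X"
      using rel_interior_convex_shrink[OF \<open>convex X\<close> y x t] by (simp add: p_def v_def algebra_simps)
    moreover have "t\<^sup>2 > 0" using t by simp
    ultimately obtain w \<zeta> where w: "(w, \<zeta>) \<in> \<Gamma>" "norm (w - p) \<le> t\<^sup>2"
      using dense by blast
    note w\<zeta> = \<Gamma>[OF w(1)]
    have pX: "p \<in> X" using \<open>p \<in> rel_interior X\<close> rel_interior_subset by blast
    obtain \<xi> where "\<xi> \<in> weak_subdiff \<rho> X h p" "norm \<xi> \<le> M" using bdd[OF pX] by blast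
    then have hp: "h p \<le> h w + M * norm (w - p) + \<rho> / 2 * (norm (w - p))\<^sup>2"
      using w\<zeta> by (intro weak_subdiff_lipschitz) auto
    have tt: "t\<^sup>2 \<le> t" using t by (simp add: power2_eq_square mult_left_le)
    have wp2: "(norm (w - p))\<^sup>2 \<le> t\<^sup>2"
      using w(2) tt t by (intro power_mono) auto
    have wx: "norm (w - x) \<le> t * (norm v + 1)"
      using norm_triangle_ineq[of "w - p" "t *\<^sub>R v"] w(2) tt t by (simp add: p_def algebra_simps)
    have "h x + t * a - L * t\<^sup>2 \<le> h w + M * t\<^sup>2 + \<rho> / 2 * t\<^sup>2"
      using growth[OF t] hp mult_left_mono[OF w(2) \<open>M \<ge> 0\<close>] mult_left_mono[OF wp2, of "\<rho> / 2"] \<open>\<rho> \<ge> 0\<close>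
      by (simp add: p_def v_def)
    moreover have "h w - h x \<le> \<zeta> \<bullet> (w - x) + \<rho> / 2 * (t * (norm v + 1))\<^sup>2"
    proof -
      have "h w + \<zeta> \<bullet> (x - w) - \<rho> / 2 * (norm (x - w))\<^sup>2 \<le> h x"
        using w\<zeta> x by (intro weak_subdiffD) auto
      moreover have "(norm (x - w))\<^sup>2 \<le> (t * (norm v + 1))\<^sup>2"
        using wx by (intro power_mono) (auto simp: norm_minus_commute)
      then have "\<rho> / 2 * (norm (x - w))\<^sup>2 \<le> \<rho> / 2 * (t * (norm v + 1))\<^sup>2"
        using \<open>\<rho> \<ge> 0\<close> by (intro mult_left_mono) auto
      ultimately show ?thesis by (simp add: inner_diff_right)
    qed
    moreover have "\<zeta> \<bullet> (w - x) \<le> t * (\<zeta> \<bullet> v) + M * t\<^sup>2"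
    proof -
      have "\<zeta> \<bullet> (w - p) \<le> M * t\<^sup>2"
        using Cauchy_Schwarz_ineq2[of \<zeta> "w - p"] w\<zeta> w(2) \<open>M \<ge> 0\<close>
        by (smt (verit) mult_mono norm_ge_zero)
      moreover have "\<zeta> \<bullet> (w - x) = \<zeta> \<bullet> (w - p) + t * (\<zeta> \<bullet> v)"
        by (simp add: p_def inner_diff_right inner_add_right)
      ultimately show ?thesis by simp
    qed
    ultimately have "t * a - t * (C * t) \<le> t * (\<zeta> \<bullet> v)"
      by (simp add: C_def power_mult_distrib power2_eq_square algebra_simps)
    then have "a - C * t \<le> \<zeta> \<bullet> v"
      using t by (simp add: right_diff_distrib[symmetric])
    with w(1) wx show ?thesis by blast
  qed
  define t :: "nat \<Rightarrow> real" where "t n = inverse (real (Suc n))" for n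
  have t: "0 < t n" "t n \<le> 1" for n by (auto simp: t_def inverse_le_1_iff)
  have t0: "t \<longlonglongrightarrow> 0" unfolding t_def by (rule LIMSEQ_inverse_real_of_nat)
  from step[OF t] obtain w \<zeta> where w: "\<And>n. (w n, \<zeta> n) \<in> \<Gamma>"
    "\<And>n. norm (w n - x) \<le> t n * (norm v + 1)" "\<And>n. a - C * t n \<le> \<zeta> n \<bullet> v"
    by metis
  have "\<forall>n. \<zeta> n \<in> cball 0 M" using \<Gamma>[OF w(1)] by simp
  then obtain l s where s: "strict_mono s" "(\<zeta> \<circ> s) \<longlonglongrightarrow> l"
    using compact_cball[of "0::'a" M] unfolding compact_def by blast
  have ts: "(\<lambda>n. t (s n)) \<longlonglongrightarrow> 0"
    using LIMSEQ_subseq_LIMSEQ[OF t0 s(1)] by (simp add: o_def)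
  have "(\<lambda>n. w (s n) - x) \<longlonglongrightarrow> 0"
    by (rule Lim_null_comparison[where g = "\<lambda>n. t (s n) * (norm v + 1)"])
       (use w(2) tendsto_mult_left_zero[OF ts] in auto)
  then have "(\<lambda>n. w (s n)) \<longlonglongrightarrow> x" by (simp add: LIM_zero_iff)
  moreover have sl: "(\<lambda>n. \<zeta> (s n)) \<longlonglongrightarrow> l" using s(2) by (simp add: o_def)
  ultimately have "(\<lambda>n. (w (s n), \<zeta> (s n))) \<longlonglongrightarrow> (x, l)" by (rule tendsto_Pair)
  then have "(x, l) \<in> closure \<Gamma>"
    unfolding closure_sequential using w(1) by (intro exI[of _ "\<lambda>n. (w (s n), \<zeta> (s n))"]) simp
  moreover have "a \<le> l \<bullet> v"
  proof (rule LIMSEQ_le)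
    show "(\<lambda>n. a - C * t (s n)) \<longlonglongrightarrow> a" using ts by (auto intro!: tendsto_eq_intros)
    show "(\<lambda>n. \<zeta> (s n) \<bullet> v) \<longlonglongrightarrow> l \<bullet> v" by (intro tendsto_intros sl)
  qed (use w(3) in auto)
  ultimately show ?thesis unfolding v_def by blast
qed

lemma convex_subdiff_eq_weak_subdiff: "convex_subdiff X h x = weak_subdiff 0 X h x"
  by (simp add: convex_subdiff_def weak_subdiff_def)

text \<open>For \<open>K\<close> this says that its support function dominates the directional derivative of \<open>h\<close> at \<open>x\<close>
  in all directions towards the relative interior of \<open>X\<close>. The term \<open>L * t\<^sup>2\<close> leaves room for the
  curvature of a proximal term.\<close>

definition dominates_slopes :: "'a::euclidean_space set \<Rightarrow> ('a \<Rightarrow> real) \<Rightarrow> 'a \<Rightarrow> 'a set \<Rightarrow> bool" where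
  "dominates_slopes X h x K \<longleftrightarrow> (\<forall>y\<in>rel_interior X. \<forall>a L.
     (\<forall>t. 0 < t \<and> t \<le> 1 \<longrightarrow> h x + t * a - L * t\<^sup>2 \<le> h (x + t *\<^sub>R (y - x)))
       \<longrightarrow> (\<exists>\<zeta>\<in>K. a \<le> \<zeta> \<bullet> (y - x)))"

text \<open>The set \<open>K\<close> is the convex hull of the limits at \<open>x\<close> of bounded gradients, or of bounded
  subgradients if \<open>h\<close> is convex. The whole subdifferential may be unbounded at the boundary of \<open>X\<close>,
  but compactness is what allows separation from the normal cone, and the bound \<open>M\<close> enters the
  estimate of the multiplier.\<close>

lemma subdiff_compact_part:
  fixes X :: "'a::euclidean_space set"
  assumes X: "closed X" "convex X" and "\<rho> \<ge> 0" and "M > 0" and cont: "continuous_on X h"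
    and wc: "weakly_convex_on \<rho> X h"
    and bdd: "\<And>x. x \<in> X \<Longrightarrow> \<exists>\<zeta>\<in>subdiff X h x. norm \<zeta> \<le> M" and x: "x \<in> X"
  obtains K where "compact K" "convex K" "K \<noteq> {}" "K \<subseteq> subdiff X h x" "K \<subseteq> cball 0 M"
    "dominates_slopes X h x K"
proof -
  define Q where "Q w \<zeta> \<longleftrightarrow> (if convex_on X h then \<zeta> \<in> convex_subdiff X h w
      else (h has_derivative (\<lambda>v. \<zeta> \<bullet> v)) (at w within X))" for w \<zeta>
  define \<Gamma> where "\<Gamma> = {(w, \<zeta>). w \<in> X \<and> norm \<zeta> \<le> M \<and> Q w \<zeta>}"
  define S where "S = {\<zeta>. (x, \<zeta>) \<in> closure \<Gamma>}"
  have weak: "\<exists>\<zeta>\<in>weak_subdiff \<rho> X h p. norm \<zeta> \<le> M" if "p \<in> X" for p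
    using bdd[OF that] subdiff_subset_weak_subdiff[OF wc X(2) \<open>\<rho> \<ge> 0\<close> cont that] by blast
  have Qweak: "\<zeta> \<in> weak_subdiff \<rho> X h w" if "w \<in> X" "Q w \<zeta>" for w \<zeta>
  proof (cases "convex_on X h")
    case True
    then have "\<zeta> \<in> subdiff X h w" using that by (simp add: Q_def subdiff_def)
    then show ?thesis using subdiff_subset_weak_subdiff[OF wc X(2) \<open>\<rho> \<ge> 0\<close> cont that(1)] by blast
  next
    case False
    then show ?thesis using that gradient_in_weak_subdiff[OF wc X(2) \<open>\<rho> \<ge> 0\<close>] by (simp add: Q_def)
  qed
  have dense: "\<exists>w \<zeta>. (w, \<zeta>) \<in> \<Gamma> \<and> norm (w - p) \<le> \<delta>" if p: "p \<in> rel_interior X" "\<delta> > 0" for p \<delta>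
  proof (cases "convex_on X h")
    case True
    have "p \<in> X" using p rel_interior_subset by blast
    then obtain \<zeta> where "\<zeta> \<in> convex_subdiff X h p" "norm \<zeta> \<le> M"
      using bdd True unfolding subdiff_def by auto
    then show ?thesis
      using \<open>p \<in> X\<close> True \<open>\<delta> > 0\<close> unfolding \<Gamma>_def Q_def
      by (intro exI[of _ p] exI[of _ \<zeta>]) auto
  next
    case False
    then show ?thesis
      using differentiability_points_dense[OF X \<open>\<rho> \<ge> 0\<close> \<open>M > 0\<close> cont weak p]
      unfolding \<Gamma>_def Q_def by auto
  qed
  have dir: "\<exists>\<zeta>\<in>S. a \<le> \<zeta> \<bullet> (y - x)"
    if "y \<in> rel_interior X"
      "\<And>t. 0 < t \<Longrightarrow> t \<le> 1 \<Longrightarrow> h x + t * a - L * t\<^sup>2 \<le> h (x + t *\<^sub>R (y - x))" for y a L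
  proof -
    have "w \<in> X \<and> \<zeta> \<in> weak_subdiff \<rho> X h w \<and> norm \<zeta> \<le> M" if "(w, \<zeta>) \<in> \<Gamma>" for w \<zeta>
      using that Qweak by (simp add: \<Gamma>_def)
    from limit_subgradient_in_direction[OF X(2) \<open>\<rho> \<ge> 0\<close> less_imp_le[OF \<open>M > 0\<close>] x that(1) weak
        this dense that(2)]
    show ?thesis by (simp add: S_def Bex_def)
  qed
  have sub: "S \<subseteq> cball 0 M"
  proof -
    have "closure \<Gamma> \<subseteq> UNIV \<times> cball 0 M"
      by (rule closure_minimal) (auto simp: \<Gamma>_def intro: closed_Times)
    then show ?thesis by (auto simp: S_def)
  qed
  have "closed S"
    using continuous_closed_vimage[OF closed_closure, of "\<lambda>\<zeta>. (x, \<zeta>)" \<Gamma>]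
    by (simp add: S_def vimage_def)
  then have "compact S"
    using sub bounded_subset[OF bounded_cball] compact_eq_bounded_closed by blast
  have hull: "convex hull S \<subseteq> subdiff X h x"
  proof (cases "convex_on X h")
    case True
    have "S \<subseteq> weak_subdiff 0 X h x"
    proof
      fix \<zeta> assume "\<zeta> \<in> S"
      then obtain z where z: "\<And>n. z n \<in> \<Gamma>" "z \<longlonglongrightarrow> (x, \<zeta>)"
        unfolding S_def closure_sequential by blast
      show "\<zeta> \<in> weak_subdiff 0 X h x"
      proof (rule weak_subdiff_limit[OF cont x])
        show "(\<lambda>n. fst (z n)) \<longlonglongrightarrow> x" using tendsto_fst[OF z(2)] by simp
        show "(\<lambda>n. snd (z n)) \<longlonglongrightarrow> \<zeta>" using tendsto_snd[OF z(2)] by simp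
        show "fst (z n) \<in> X" "snd (z n) \<in> weak_subdiff 0 X h (fst (z n))" for n
          using z(1)[of n] True by (auto simp: \<Gamma>_def Q_def convex_subdiff_eq_weak_subdiff)
      qed
    qed
    then show ?thesis
      using True by (simp add: subdiff_def convex_subdiff_eq_weak_subdiff hull_minimal convex_weak_subdiff)
  next
    case False
    have "S \<subseteq> {\<zeta>. \<exists>xs \<zeta>s. (\<forall>i::nat. xs i \<in> X \<and>
                  (h has_derivative (\<lambda>v. \<zeta>s i \<bullet> v)) (at (xs i) within X)) \<and>
               xs \<longlonglongrightarrow> x \<and> \<zeta>s \<longlonglongrightarrow> \<zeta>}"
    proof
      fix \<zeta> assume "\<zeta> \<in> S"
      then obtain z where z: "\<And>n. z n \<in> \<Gamma>" "z \<longlonglongrightarrow> (x, \<zeta>)"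
        unfolding S_def closure_sequential by blast
      have "(\<lambda>n. fst (z n)) \<longlonglongrightarrow> x" "(\<lambda>n. snd (z n)) \<longlonglongrightarrow> \<zeta>"
        using tendsto_fst[OF z(2)] tendsto_snd[OF z(2)] by simp_all
      moreover have "fst (z n) \<in> X"
        "(h has_derivative (\<lambda>v. snd (z n) \<bullet> v)) (at (fst (z n)) within X)" for n
        using z(1)[of n] False by (auto simp: \<Gamma>_def Q_def)
      ultimately show "\<zeta> \<in> {\<zeta>. \<exists>xs \<zeta>s. (\<forall>i::nat. xs i \<in> X \<and>
                  (h has_derivative (\<lambda>v. \<zeta>s i \<bullet> v)) (at (xs i) within X)) \<and>
               xs \<longlonglongrightarrow> x \<and> \<zeta>s \<longlonglongrightarrow> \<zeta>}"
        by (intro CollectI exI[of _ "\<lambda>n. fst (z n)"] exI[of _ "\<lambda>n. snd (z n)"]) simp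
    qed
    then show ?thesis
      using False by (simp add: subdiff_def clarke_subdiff_def hull_mono)
  qed
  have "S \<noteq> {}"
  proof -
    obtain y where y: "y \<in> rel_interior X"
      using x rel_interior_eq_empty[OF X(2)] by blast
    obtain \<xi> where \<xi>: "\<xi> \<in> weak_subdiff \<rho> X h x" using weak[OF x] by blast
    have "h x + t * (\<xi> \<bullet> (y - x)) - \<rho> / 2 * (norm (y - x))\<^sup>2 * t\<^sup>2 \<le> h (x + t *\<^sub>R (y - x))"
      if "0 < t" "t \<le> 1" for t
    proof -
      have "x + t *\<^sub>R (y - x) = (1 - t) *\<^sub>R x + t *\<^sub>R y" by (simp add: algebra_simps)
      then have "x + t *\<^sub>R (y - x) \<in> X"
        using convexD_alt[OF X(2) x, of y t] y rel_interior_subset that by auto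
      from weak_subdiffD[OF \<xi> this] show ?thesis
        by (simp add: power_mult_distrib mult_ac)
    qed
    from dir[OF y this] show ?thesis by blast
  qed
  show thesis
  proof
    show "compact (convex hull S)" by (rule compact_convex_hull) fact
    show "convex (convex hull S)" by simp
    show "convex hull S \<noteq> {}" using \<open>S \<noteq> {}\<close> by simp
    show "convex hull S \<subseteq> subdiff X h x" by (fact hull)
    show "convex hull S \<subseteq> cball 0 M" by (rule hull_minimal) (use sub in auto)
    show "dominates_slopes X h x (convex hull S)"
      unfolding dominates_slopes_def
    proof (intro ballI allI impI)
      fix y a L assume y: "y \<in> rel_interior X"
        and growth: "\<forall>t. 0 < t \<and> t \<le> 1 \<longrightarrow> h x + t * a - L * t\<^sup>2 \<le> h (x + t *\<^sub>R (y - x))"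
      have "\<exists>\<zeta>\<in>S. a \<le> \<zeta> \<bullet> (y - x)" by (rule dir[OF y, of a L]) (use growth in blast)
      then show "\<exists>\<zeta>\<in>convex hull S. a \<le> \<zeta> \<bullet> (y - x)" by (meson hull_inc)
    qed
  qed
qed

section \<open>Fritz John conditions for the proximal subproblem\<close>

text \<open>This exchanges the quantifiers in the hypothesis. If \<open>K\<close> missed the polar cone of all \<open>y - x\<close>, a
  hyperplane would separate the two; by the bipolar theorem the normal of
  the hyperplane is a limit of directions \<open>c *\<^sub>R (y - x)\<close>, and one of these already violates the
  hypothesis.\<close>

lemma compact_convex_meets_polar_cone:
  fixes Y K :: "'a::euclidean_space set"
  assumes Y: "convex Y" "Y \<noteq> {}" and K: "compact K" "convex K"
    and meets: "\<And>y. y \<in> Y \<Longrightarrow> \<exists>\<zeta>\<in>K. 0 \<le> \<zeta> \<bullet> (y - x)"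
  shows "\<exists>\<zeta>\<in>K. \<forall>y\<in>Y. 0 \<le> \<zeta> \<bullet> (y - x)"
proof (rule ccontr)
  assume contra: "\<not> ?thesis"
  define P where "P = {\<zeta>. \<forall>y\<in>Y. 0 \<le> \<zeta> \<bullet> (y - x)}"
  have P_eq: "P = (\<Inter>y\<in>Y. {\<zeta>. 0 \<le> (y - x) \<bullet> \<zeta>})"
    unfolding P_def by (auto simp: inner_commute)
  have P: "convex P" "closed P"
    unfolding P_eq by (auto intro!: convex_INT closed_INT simp: convex_halfspace_ge closed_halfspace_ge)
  have "K \<inter> P = {}" using contra by (auto simp: P_def)
  moreover have "K \<noteq> {}" using meets Y by blast
  ultimately obtain a b where a: "\<And>k. k \<in> K \<Longrightarrow> a \<bullet> k < b" "\<And>p. p \<in> P \<Longrightarrow> b < a \<bullet> p"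
    using separating_hyperplane_compact_closed[of K P] K P by blast
  have "0 \<in> P" by (simp add: P_def)
  from a(2)[OF this] have "b < 0" by simp
  have aP: "0 \<le> a \<bullet> p" if p: "p \<in> P" for p
  proof (rule ccontr)
    assume neg: "\<not> ?thesis"
    define c where "c = b / (a \<bullet> p)"
    have "c \<ge> 0" using neg \<open>b < 0\<close> by (simp add: c_def divide_nonpos_neg)
    then have "c *\<^sub>R p \<in> P" using p by (simp add: P_def)
    from a(2)[OF this] show False using neg by (simp add: c_def)
  qed
  define T where "T = cone hull ((\<lambda>y. y - x) ` Y)"
  have T_eq: "T = {c *\<^sub>R (y - x) | c y. 0 \<le> c \<and> y \<in> Y}"
    unfolding T_def cone_hull_expl by blast
  have "convex T"
    unfolding T_def using Y by (intro convex_cone_hull convex_translation_subtract)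
  have "a \<in> closure T"
  proof (rule ccontr)
    assume "a \<notin> closure T"
    then obtain n e where n: "n \<bullet> a < e" "\<And>z. z \<in> T \<Longrightarrow> e < n \<bullet> z"
      using separating_hyperplane_closed_point[of "closure T" a] \<open>convex T\<close> closure_subset
      by (metis closed_closure convex_closure subsetD)
    have "0 \<in> T" unfolding T_eq using Y by force
    from n(2)[OF this] have "e < 0" by simp
    have "0 \<le> n \<bullet> (y - x)" if y: "y \<in> Y" for y
    proof (rule ccontr)
      assume neg: "\<not> ?thesis"
      define c where "c = e / (n \<bullet> (y - x))"
      have "c \<ge> 0" using neg \<open>e < 0\<close> by (simp add: c_def divide_nonpos_neg)
      then have "c *\<^sub>R (y - x) \<in> T" using y unfolding T_eq by blast
      from n(2)[OF this] show False using neg by (simp add: c_def)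
    qed
    then have "n \<in> P" by (simp add: P_def)
    from aP[OF this] n(1) \<open>e < 0\<close> show False by (simp add: inner_commute)
  qed
  obtain R where R: "R > 0" "\<And>k. k \<in> K \<Longrightarrow> norm k \<le> R"
    using compact_imp_bounded[OF K(1)] unfolding bounded_pos by blast
  have "- b / R > 0" using \<open>b < 0\<close> R by (simp add: divide_neg_pos)
  with \<open>a \<in> closure T\<close> obtain c y where c: "0 \<le> c" "y \<in> Y" "dist (c *\<^sub>R (y - x)) a < - b / R"
    unfolding closure_approachable T_eq by blast
  from meets[OF c(2)] obtain \<zeta> where \<zeta>: "\<zeta> \<in> K" "0 \<le> \<zeta> \<bullet> (y - x)" by blast
  have "\<zeta> \<bullet> (c *\<^sub>R (y - x) - a) \<le> norm \<zeta> * norm (c *\<^sub>R (y - x) - a)"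
    by (rule norm_cauchy_schwarz)
  also have "\<dots> \<le> R * (- b / R)"
    using R \<zeta>(1) c(3) by (intro mult_mono) (auto simp: dist_norm)
  finally have "\<zeta> \<bullet> (c *\<^sub>R (y - x)) - \<zeta> \<bullet> a \<le> - b" using R by (simp add: inner_diff_right)
  moreover have "0 \<le> \<zeta> \<bullet> (c *\<^sub>R (y - x))" using \<zeta>(2) c(1) by simp
  ultimately show False using a(1)[OF \<zeta>(1)] by (simp add: inner_commute)
qed


lemma prox_fun_descent_direction:
  assumes K: "dominates_slopes X h x K"
    and y: "y \<in> rel_interior X"
    and neg: "\<And>\<zeta>. \<zeta> \<in> K \<Longrightarrow> (\<zeta> + \<rho>' *\<^sub>R (x - c)) \<bullet> (y - x) < 0"
  shows "\<exists>t. 0 < t \<and> t \<le> 1 \<and> prox_fun \<rho>' h c (x + t *\<^sub>R (y - x)) < prox_fun \<rho>' h c x"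
proof (rule ccontr)
  assume contra: "\<not> ?thesis"
  define a where "a = - \<rho>' * ((x - c) \<bullet> (y - x))"
  have "h x + t * a - \<rho>' / 2 * (norm (y - x))\<^sup>2 * t\<^sup>2 \<le> h (x + t *\<^sub>R (y - x))" if t: "0 < t" "t \<le> 1" for t
  proof -
    have "(norm (x + t *\<^sub>R (y - x) - c))\<^sup>2
        = (norm (x - c))\<^sup>2 + 2 * t * ((x - c) \<bullet> (y - x)) + t\<^sup>2 * (norm (y - x))\<^sup>2"
      unfolding power2_norm_eq_inner
      by (simp add: inner_diff_left inner_diff_right inner_add_left inner_add_right inner_commute
          power2_eq_square) (simp add: algebra_simps)
    moreover have "prox_fun \<rho>' h c x \<le> prox_fun \<rho>' h c (x + t *\<^sub>R (y - x))"
      using contra t by force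
    ultimately show ?thesis
      unfolding prox_fun_def a_def by (simp add: field_simps)
  qed
  with K y have "\<exists>\<zeta>\<in>K. a \<le> \<zeta> \<bullet> (y - x)"
    unfolding dominates_slopes_def by blast
  then obtain \<zeta> where "\<zeta> \<in> K" "a \<le> \<zeta> \<bullet> (y - x)" by blast
  with neg[of \<zeta>] show False by (simp add: a_def inner_add_left)
qed

lemma convex_on_descent_near:
  assumes "convex_on X H" "x \<in> X" "x + t *\<^sub>R v \<in> X" "H (x + t *\<^sub>R v) < H x" "0 < s" "s \<le> t"
  shows "H (x + s *\<^sub>R v) < H x"
proof -
  have st: "0 < s / t" "s / t \<le> 1" using assms by auto
  have eq: "(1 - s / t) *\<^sub>R x + (s / t) *\<^sub>R (x + t *\<^sub>R v) = x + s *\<^sub>R v"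
    using assms by (simp add: algebra_simps)
  have "H (x + s *\<^sub>R v) \<le> (1 - s / t) * H x + (s / t) * H (x + t *\<^sub>R v)"
    using convex_onD[OF assms(1), of "s / t" x "x + t *\<^sub>R v"] st assms(2,3) by (simp add: eq)
  also have "\<dots> < (1 - s / t) * H x + (s / t) * H x"
    using st assms(4) by (intro add_strict_left_mono mult_strict_left_mono)
  finally show ?thesis by (simp add: algebra_simps)
qed

lemma prox_subproblem_has_solution:
  fixes X :: "'a::euclidean_space set"
  assumes "closed X" and f: "continuous_on X f" "bdd_below (f ` X)" and g: "continuous_on X g"
    and "\<rho>' > 0" and c: "c \<in> X" "g c \<le> 0"
  shows "\<exists>x. optimal_solution X (prox_fun \<rho>' f c) (prox_fun \<rho>' g c) x"
proof -
  define F G where "F = prox_fun \<rho>' f c" and "G = prox_fun \<rho>' g c"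
  from f(2) obtain m where m: "\<And>x. x \<in> X \<Longrightarrow> m \<le> f x" unfolding bdd_below_def by blast
  define R where "R = sqrt (2 * (f c - m) / \<rho>')"
  have "2 * (f c - m) / \<rho>' \<ge> 0" using m[OF c(1)] \<open>\<rho>' > 0\<close> by simp
  then have R: "R \<ge> 0" "R\<^sup>2 = 2 * (f c - m) / \<rho>'" by (auto simp: R_def)
  have cF: "continuous_on X F" and cG: "continuous_on X G"
    unfolding F_def G_def prox_fun_def by (intro continuous_intros f g)+
  define S where "S = X \<inter> G -` {..0}"
  have "closed S"
    unfolding S_def using continuous_on_closed_vimage[OF \<open>closed X\<close>, of G] cG
    by (simp add: Int_commute)
  then have "compact (S \<inter> cball c R)" by (simp add: closed_Int_compact)
  moreover have "c \<in> S \<inter> cball c R" using c R by (simp add: S_def G_def prox_fun_def)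
  moreover have "continuous_on (S \<inter> cball c R) F"
    by (rule continuous_on_subset[OF cF]) (auto simp: S_def)
  ultimately obtain x where x: "x \<in> S \<inter> cball c R" "\<And>y. y \<in> S \<inter> cball c R \<Longrightarrow> F x \<le> F y"
    using continuous_attains_inf[of "S \<inter> cball c R" F] by blast
  have "F x \<le> F y" if y: "y \<in> S" for y
  proof (cases "y \<in> cball c R")
    case False
    then have "R\<^sup>2 \<le> (norm (y - c))\<^sup>2"
      using R(1) by (intro power_mono) (auto simp: dist_norm norm_minus_commute)
    then have "\<rho>' / 2 * R\<^sup>2 \<le> \<rho>' / 2 * (norm (y - c))\<^sup>2" using \<open>\<rho>' > 0\<close> by simp
    moreover have "\<rho>' / 2 * R\<^sup>2 = f c - m" using R \<open>\<rho>' > 0\<close> by simp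
    moreover have "m \<le> f y" using m y by (simp add: S_def)
    ultimately have "F c \<le> F y" by (simp add: F_def prox_fun_def)
    with x(2)[OF \<open>c \<in> S \<inter> cball c R\<close>] show ?thesis by simp
  qed (use x y in auto)
  with x(1) show ?thesis
    unfolding optimal_solution_def is_arg_min_def F_def[symmetric] G_def[symmetric]
    by (intro exI[of _ x]) (auto simp: S_def not_less)
qed

locale weakly_convex_problem =
  fixes X :: "'a::euclidean_space set" and f g :: "'a \<Rightarrow> real" and \<rho> \<rho>' M glb :: real
  assumes closed_X: "closed X" and convex_X: "convex X"
    and rho_nonneg: "\<rho> \<ge> 0" and rho_less: "\<rho> < \<rho>'" and rho'_gt_1: "\<rho>' > 1" and M_pos: "M > 0"
    and f: "continuous_on X f" "weakly_convex_on \<rho> X f"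
      "\<And>x. x \<in> X \<Longrightarrow> \<exists>\<zeta>\<in>subdiff X f x. norm \<zeta> \<le> M"
    and g: "continuous_on X g" "weakly_convex_on \<rho> X g"
      "\<And>x. x \<in> X \<Longrightarrow> \<exists>\<zeta>\<in>subdiff X g x. norm \<zeta> \<le> M"
    and f_bdd: "bdd_below (f ` X)" and glb_le: "\<And>x. x \<in> X \<Longrightarrow> glb \<le> g x"
begin

lemma prox_convex: "convex_on X (prox_fun \<rho>' f c)" "convex_on X (prox_fun \<rho>' g c)"
  using prox_fun_convex_on[OF f(2) convex_X] prox_fun_convex_on[OF g(2) convex_X] rho_less
  by auto

lemmas subdiff_f_weak = subsetD[OF subdiff_subset_weak_subdiff[OF f(2) convex_X rho_nonneg f(1)]]
lemmas subdiff_g_weak = subsetD[OF subdiff_subset_weak_subdiff[OF g(2) convex_X rho_nonneg g(1)]]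

text \<open>If all combinations of bounded subgradients had negative slope in one direction from the
  solution \<open>x\<close> into the relative interior, a short step would decrease the objective and keep the
  constraint satisfied. So in each such direction some combination has nonnegative slope, and
  \<open>compact_convex_meets_polar_cone\<close> yields a single combination for all directions. If the
  constraint is inactive, the subgradients of \<open>f\<close> alone are used, which gives \<open>\<gamma> = 0\<close>. The bound on \<open>\<zeta>f\<close> serves the multiplier
  estimate under the constraint qualification.\<close>

lemma prox_subproblem_fritz_john:
  assumes opt: "optimal_solution X (prox_fun \<rho>' f c) (prox_fun \<rho>' g c) x"
  shows "\<exists>\<zeta>f\<in>subdiff X f x. \<exists>\<zeta>g\<in>subdiff X g x. \<exists>\<gamma>0\<ge>0. \<exists>\<gamma>\<ge>0. \<gamma>0 + \<gamma> = 1 \<and> norm \<zeta>f \<le> M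
    \<and> \<gamma> * prox_fun \<rho>' g c x = 0
    \<and> - (\<gamma>0 *\<^sub>R (\<zeta>f + \<rho>' *\<^sub>R (x - c)) + \<gamma> *\<^sub>R (\<zeta>g + \<rho>' *\<^sub>R (x - c))) \<in> normal_cone X x"
proof -
  define F G where "F = prox_fun \<rho>' f c" and "G = prox_fun \<rho>' g c"
  have x: "x \<in> X" "G x \<le> 0" and min: "\<And>w. w \<in> X \<Longrightarrow> G w \<le> 0 \<Longrightarrow> F x \<le> F w"
    using opt unfolding optimal_solution_def is_arg_min_def F_def G_def by force+
  have conv: "convex_on X F" "convex_on X G"
    unfolding F_def G_def by (rule prox_convex)+
  obtain Kf where Kf: "compact Kf" "convex Kf" "Kf \<noteq> {}" "Kf \<subseteq> subdiff X f x" "Kf \<subseteq> cball 0 M"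
    and dirf: "dominates_slopes X f x Kf"
    by (rule subdiff_compact_part[OF closed_X convex_X rho_nonneg M_pos f x(1)]) blast
  obtain Kg where Kg: "compact Kg" "convex Kg" "Kg \<noteq> {}" "Kg \<subseteq> subdiff X g x"
    and dirg: "dominates_slopes X g x Kg"
    by (rule subdiff_compact_part[OF closed_X convex_X rho_nonneg M_pos g x(1)]) blast
  define d where "d = \<rho>' *\<^sub>R (x - c)"
  define Lf where "Lf = (+) d ` Kf"
  define Lg where "Lg = (+) d ` Kg"
  have Lf: "compact Lf" "convex Lf" "Lf \<noteq> {}"
    unfolding Lf_def using Kf by (simp_all add: compact_translation convex_translation)
  have Lg: "compact Lg" "convex Lg" "Lg \<noteq> {}"
    unfolding Lg_def using Kg by (simp_all add: compact_translation convex_translation)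
  define R where "R = rel_interior X"
  have R: "convex R" "R \<noteq> {}" "R \<subseteq> X" "X \<subseteq> closure R"
    using convex_X x convex_rel_interior[OF convex_X] rel_interior_eq_empty[OF convex_X] rel_interior_subset[of X]
      convex_closure_rel_interior[OF convex_X] closure_subset[of X] unfolding R_def by auto
  have seg: "x + t *\<^sub>R (y - x) \<in> X" if "y \<in> R" "0 < t" "t \<le> 1" for y t
  proof -
    have "x + t *\<^sub>R (y - x) = (1 - t) *\<^sub>R x + t *\<^sub>R y" by (simp add: algebra_simps)
    then show ?thesis using convexD_alt[OF convex_X x(1), of y t] R that by auto
  qed
  have desc_f: "\<exists>t. 0 < t \<and> t \<le> 1 \<and> F (x + t *\<^sub>R (y - x)) < F x"
    if "y \<in> R" "\<And>\<zeta>. \<zeta> \<in> Lf \<Longrightarrow> \<zeta> \<bullet> (y - x) < 0" for y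
  proof -
    have "(\<zeta> + \<rho>' *\<^sub>R (x - c)) \<bullet> (y - x) < 0" if "\<zeta> \<in> Kf" for \<zeta>
      using that(1) \<open>\<And>\<zeta>. \<zeta> \<in> Lf \<Longrightarrow> \<zeta> \<bullet> (y - x) < 0\<close>[of "d + \<zeta>"]
      by (simp add: Lf_def d_def add.commute)
    from prox_fun_descent_direction[OF dirf that(1)[unfolded R_def] this]
    show ?thesis unfolding F_def .
  qed
  have desc_g: "\<exists>t. 0 < t \<and> t \<le> 1 \<and> G (x + t *\<^sub>R (y - x)) < G x"
    if "y \<in> R" "\<And>\<zeta>. \<zeta> \<in> Lg \<Longrightarrow> \<zeta> \<bullet> (y - x) < 0" for y
  proof -
    have "(\<zeta> + \<rho>' *\<^sub>R (x - c)) \<bullet> (y - x) < 0" if "\<zeta> \<in> Kg" for \<zeta>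
      using that(1) \<open>\<And>\<zeta>. \<zeta> \<in> Lg \<Longrightarrow> \<zeta> \<bullet> (y - x) < 0\<close>[of "d + \<zeta>"]
      by (simp add: Lg_def d_def add.commute)
    from prox_fun_descent_direction[OF dirg that(1)[unfolded R_def] this]
    show ?thesis unfolding G_def .
  qed
  have to_normal: "- \<zeta> \<in> normal_cone X x" if "\<forall>y\<in>R. 0 \<le> \<zeta> \<bullet> (y - x)" for \<zeta>
  proof -
    have "closed {y. 0 \<le> \<zeta> \<bullet> (y - x)}"
      by (simp add: inner_diff_right closed_halfspace_ge)
    then have "closure R \<subseteq> {y. 0 \<le> \<zeta> \<bullet> (y - x)}"
      using that by (intro closure_minimal) auto
    then show ?thesis using R(4) by (auto simp: normal_cone_def)
  qed
  obtain \<zeta>f \<zeta>g \<gamma>0 \<gamma> where z: "\<zeta>f \<in> Kf" "\<zeta>g \<in> Kg" "\<gamma>0 \<ge> 0" "\<gamma> \<ge> 0" "\<gamma>0 + \<gamma> = 1" "\<gamma> * G x = 0"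
    "\<forall>y\<in>R. 0 \<le> (\<gamma>0 *\<^sub>R (d + \<zeta>f) + \<gamma> *\<^sub>R (d + \<zeta>g)) \<bullet> (y - x)"
  proof (cases "G x < 0")
    case True
    have "\<exists>\<zeta>\<in>Lf. 0 \<le> \<zeta> \<bullet> (y - x)" if y: "y \<in> R" for y
    proof (rule ccontr)
      assume "\<not> ?thesis"
      with desc_f[OF y] obtain t where t: "0 < t" "t \<le> 1" "F (x + t *\<^sub>R (y - x)) < F x" by force
      \<comment> \<open>The step \<open>s\<close> is short enough for the slack of the inactive constraint.\<close>
      define m where "m = \<bar>G y - G x\<bar> + 1"
      have "m > 0" by (simp add: m_def add_nonneg_pos)
      define s where "s = min t (- G x / m)"
      have s: "0 < s" "s \<le> t" "s \<le> 1" "s \<le> - G x / m"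
        using t True by (auto simp: s_def m_def divide_neg_pos)
      have "(1 - s) *\<^sub>R x + s *\<^sub>R y = x + s *\<^sub>R (y - x)" by (simp add: algebra_simps)
      then have "G (x + s *\<^sub>R (y - x)) \<le> (1 - s) * G x + s * G y"
        using convex_onD[OF conv(2), of s x y] s x y R by auto
      also have "\<dots> = G x + s * (G y - G x)" by (simp add: algebra_simps)
      also have "\<dots> \<le> G x + s * m"
        using s by (intro add_left_mono mult_left_mono) (auto simp: m_def)
      also have "\<dots> \<le> 0" using s(4) \<open>m > 0\<close> by (simp add: pos_le_minus_divide_eq)
      finally have "F x \<le> F (x + s *\<^sub>R (y - x))" using min seg[OF y s(1,3)] by blast
      with convex_on_descent_near[OF conv(1) x(1) seg[OF y t(1,2)] t(3) s(1,2)] show False by simp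
    qed
    from compact_convex_meets_polar_cone[OF R(1,2) Lf(1,2) this]
    obtain \<zeta> where "\<zeta> \<in> Kf" "\<forall>y\<in>R. 0 \<le> (d + \<zeta>) \<bullet> (y - x)"
      unfolding Lf_def by blast
    with Kg(3) that[of \<zeta> _ 1 0] show thesis by auto
  next
    case False
    with x have G0: "G x = 0" by simp
    have "\<exists>\<zeta>\<in>convex hull (Lf \<union> Lg). 0 \<le> \<zeta> \<bullet> (y - x)" if y: "y \<in> R" for y
    proof (rule ccontr)
      assume "\<not> ?thesis"
      then have neg: "\<zeta> \<bullet> (y - x) < 0" if "\<zeta> \<in> Lf \<union> Lg" for \<zeta>
        using that hull_subset[of "Lf \<union> Lg" convex] by force
      from desc_f[OF y] neg obtain t where t: "0 < t" "t \<le> 1" "F (x + t *\<^sub>R (y - x)) < F x" by auto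
      from desc_g[OF y] neg obtain t' where t': "0 < t'" "t' \<le> 1" "G (x + t' *\<^sub>R (y - x)) < G x" by auto
      define s where "s = min t t'"
      have s: "0 < s" "s \<le> t" "s \<le> t'" "s \<le> 1" using t t' by (auto simp: s_def)
      have "F (x + s *\<^sub>R (y - x)) < F x"
        by (rule convex_on_descent_near[OF conv(1) x(1) seg[OF y t(1,2)] t(3) s(1,2)])
      moreover have "G (x + s *\<^sub>R (y - x)) < G x"
        by (rule convex_on_descent_near[OF conv(2) x(1) seg[OF y t'(1,2)] t'(3) s(1,3)])
      ultimately show False using min[OF seg[OF y s(1,4)]] G0 by simp
    qed
    moreover have "compact (convex hull (Lf \<union> Lg))"
      using Lf Lg by (intro compact_convex_hull compact_Un)
    ultimately obtain \<zeta> where \<zeta>: "\<zeta> \<in> convex hull (Lf \<union> Lg)" "\<forall>y\<in>R. 0 \<le> \<zeta> \<bullet> (y - x)"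
      using compact_convex_meets_polar_cone[OF R(1,2), of "convex hull (Lf \<union> Lg)" x] by auto
    from \<zeta>(1) obtain u v a b where "\<zeta> = u *\<^sub>R a + v *\<^sub>R b" "0 \<le> u" "0 \<le> v" "u + v = 1" "a \<in> Lf" "b \<in> Lg"
      unfolding convex_hull_union_two[OF Lf(2,3) Lg(2,3)] by blast
    moreover from this obtain \<zeta>f \<zeta>g where "a = d + \<zeta>f" "\<zeta>f \<in> Kf" "b = d + \<zeta>g" "\<zeta>g \<in> Kg"
      unfolding Lf_def Lg_def by blast
    ultimately show thesis using \<zeta>(2) G0 by (intro that[of \<zeta>f \<zeta>g u v]) simp_all
  qed
  have "- (\<gamma>0 *\<^sub>R (\<zeta>f + d) + \<gamma> *\<^sub>R (\<zeta>g + d)) \<in> normal_cone X x"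
    using to_normal[OF z(7)] by (simp only: add.commute[of d])
  moreover have "\<zeta>f \<in> subdiff X f x" "\<zeta>g \<in> subdiff X g x" "norm \<zeta>f \<le> M"
    using z(1,2) Kf(4,5) Kg(4) by (auto simp: subset_iff)
  ultimately show ?thesis
    using z(3-6) unfolding G_def[symmetric] d_def[symmetric] by blast
qed

text \<open>Feasibility for the subproblem keeps \<open>x\<close> near the centre because \<open>g\<close> is bounded below.\<close>

lemma prox_feasible_near:
  assumes "x \<in> X" "prox_fun \<rho>' g c x \<le> 0"
  shows "(norm (x - c))\<^sup>2 \<le> (- 8 * glb) / (\<rho>' - \<rho>)"
proof -
  have 1: "\<rho>' * (norm (x - c))\<^sup>2 \<le> - 2 * glb"
    using assms glb_le[OF assms(1)] by (simp add: prox_fun_def)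
  have "(\<rho>' - \<rho>) * (norm (x - c))\<^sup>2 \<le> \<rho>' * (norm (x - c))\<^sup>2"
    using rho_nonneg by (intro mult_right_mono) auto
  moreover have "0 \<le> \<rho>' * (norm (x - c))\<^sup>2" using rho'_gt_1 by simp
  ultimately have "(\<rho>' - \<rho>) * (norm (x - c))\<^sup>2 \<le> - 8 * glb" using 1 by linarith
  then show ?thesis using rho_less by (subst pos_le_divide_eq) (auto simp: mult.commute)
qed

section \<open>Approximate stationarity of nearby subproblem solutions\<close>

text \<open>The Fritz John conditions of the subproblem differ from those of the original problem by the
  gradient \<open>\<rho>' *\<^sub>R (x - c)\<close> of the proximal term, which is small if \<open>x\<close> is near \<open>c\<close>; complementary
  slackness is perturbed by a multiple of the squared distance only.\<close>

lemma near_prox_solution_FJ: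
  assumes opt: "optimal_solution X (prox_fun \<rho>' f c) (prox_fun \<rho>' g c) x"
    and near: "\<rho>' * norm (x - c) \<le> \<epsilon>"
  shows "FJ_point \<epsilon> X f g x"
proof -
  have x: "x \<in> X" "prox_fun \<rho>' g c x \<le> 0"
    using opt unfolding optimal_solution_def is_arg_min_def by auto
  obtain \<zeta>f \<zeta>g \<gamma>0 \<gamma> where z: "\<zeta>f \<in> subdiff X f x" "\<zeta>g \<in> subdiff X g x" "\<gamma>0 \<ge> 0" "\<gamma> \<ge> 0" "\<gamma>0 + \<gamma> = 1"
    and slack: "\<gamma> * prox_fun \<rho>' g c x = 0"
    and normal: "- (\<gamma>0 *\<^sub>R (\<zeta>f + \<rho>' *\<^sub>R (x - c)) + \<gamma> *\<^sub>R (\<zeta>g + \<rho>' *\<^sub>R (x - c))) \<in> normal_cone X x"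
    using prox_subproblem_fritz_john[OF opt] by blast
  define n where "n = - (\<gamma>0 *\<^sub>R (\<zeta>f + \<rho>' *\<^sub>R (x - c)) + \<gamma> *\<^sub>R (\<zeta>g + \<rho>' *\<^sub>R (x - c)))"
  have "\<gamma>0 *\<^sub>R \<zeta>f + \<gamma> *\<^sub>R \<zeta>g - (- n) = - ((\<gamma>0 + \<gamma>) *\<^sub>R (\<rho>' *\<^sub>R (x - c)))"
    by (simp add: n_def algebra_simps)
  then have "dist (\<gamma>0 *\<^sub>R \<zeta>f + \<gamma> *\<^sub>R \<zeta>g) (- n) \<le> \<epsilon>"
    using near rho'_gt_1 z(5) unfolding dist_norm by simp
  moreover have "- n \<in> uminus ` normal_cone X x" using normal unfolding n_def by (rule imageI)
  ultimately have "infdist (\<gamma>0 *\<^sub>R \<zeta>f + \<gamma> *\<^sub>R \<zeta>g) (uminus ` normal_cone X x) \<le> \<epsilon>"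
    by (rule infdist_le2[rotated])
  moreover have "\<bar>\<gamma> * g x\<bar> \<le> \<epsilon>\<^sup>2"
  proof -
    have "\<gamma> * g x = - (\<gamma> * (\<rho>' / 2) * (norm (x - c))\<^sup>2)"
      using slack unfolding prox_fun_def by (simp add: distrib_left mult.assoc)
    then have "\<bar>\<gamma> * g x\<bar> = \<gamma> * (\<rho>' / 2) * (norm (x - c))\<^sup>2"
      using z(4) rho'_gt_1 by (simp add: abs_mult)
    also have "\<dots> \<le> \<rho>'\<^sup>2 * (norm (x - c))\<^sup>2"
    proof (intro mult_right_mono)
      have "\<gamma> * (\<rho>' / 2) \<le> 1 * (\<rho>' * \<rho>')"
        using z(3-5) rho'_gt_1 by (intro mult_mono) auto
      then show "\<gamma> * (\<rho>' / 2) \<le> \<rho>'\<^sup>2" by (simp add: power2_eq_square)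
    qed simp
    also have "\<dots> = (\<rho>' * norm (x - c))\<^sup>2" by (simp add: power_mult_distrib)
    also have "\<dots> \<le> \<epsilon>\<^sup>2" using near rho'_gt_1 by (intro power_mono) auto
    finally show ?thesis .
  qed
  moreover have "g x \<le> 0"
  proof -
    have "0 \<le> \<rho>' / 2 * (norm (x - c))\<^sup>2" using rho'_gt_1 by simp
    with x(2) show ?thesis unfolding prox_fun_def by linarith
  qed
  ultimately show ?thesis unfolding FJ_point_def using x z by blast
qed

text \<open>Testing the Fritz John condition with the direction \<open>v\<close> of the constraint qualification
  bounds the multiplier of the constraint by that of the objective. Dividing by the latter gives
  KKT multipliers at the price of the factor \<open>1 + B\<close>.\<close>

lemma near_prox_solution_KKT:
  assumes opt: "optimal_solution X (prox_fun \<rho>' f c) (prox_fun \<rho>' g c) x"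
    and mfcq: "strong_MFCQ \<sigma> X (prox_fun \<rho>' g c)" and "\<sigma> > 0"
    and D: "norm (x - c) \<le> D" and B: "B = (M + \<rho>' * D) / \<sigma>"
    and near: "(1 + B) * (\<rho>' * norm (x - c)) \<le> \<epsilon>"
  shows "KKT_point \<epsilon> X f g x"
proof -
  have x: "x \<in> X" "prox_fun \<rho>' g c x \<le> 0"
    using opt unfolding optimal_solution_def is_arg_min_def by auto
  obtain \<zeta>f \<zeta>g \<gamma>0 \<gamma> where z: "\<zeta>f \<in> subdiff X f x" "\<zeta>g \<in> subdiff X g x" "\<gamma>0 \<ge> 0" "\<gamma> \<ge> 0" "\<gamma>0 + \<gamma> = 1"
    and M: "norm \<zeta>f \<le> M" and slack: "\<gamma> * prox_fun \<rho>' g c x = 0"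
    and normal: "- (\<gamma>0 *\<^sub>R (\<zeta>f + \<rho>' *\<^sub>R (x - c)) + \<gamma> *\<^sub>R (\<zeta>g + \<rho>' *\<^sub>R (x - c))) \<in> normal_cone X x"
    using prox_subproblem_fritz_john[OF opt] by blast
  define d where "d = \<rho>' *\<^sub>R (x - c)"
  define n where "n = - (\<gamma>0 *\<^sub>R (\<zeta>f + d) + \<gamma> *\<^sub>R (\<zeta>g + d))"
  have nN: "n \<in> normal_cone X x" using normal by (simp add: n_def d_def)
  have "D \<ge> 0" using D norm_ge_zero order_trans by blast
  have B0: "B \<ge> 0" using \<open>D \<ge> 0\<close> \<open>\<sigma> > 0\<close> rho'_gt_1 M_pos by (simp add: B)
  have d_le: "norm d \<le> \<rho>' * D" unfolding d_def using D rho'_gt_1 by simp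
  have bound: "\<gamma> \<le> \<gamma>0 * B"
  proof (cases "\<gamma> = 0")
    case False
    then have G0: "prox_fun \<rho>' g c x = 0" using slack by simp
    from mfcq x(1) obtain v where v: "v \<in> uminus ` dual_normal_cone X x" "norm v = 1"
      "prox_fun \<rho>' g c x = 0 \<longrightarrow> (\<forall>\<zeta>\<in>subdiff X (prox_fun \<rho>' g c) x. \<zeta> \<bullet> v \<le> - \<sigma>)"
      unfolding strong_MFCQ_def by blast
    have "prox_fun \<rho>' g c x + (\<zeta>g + d) \<bullet> (y - x) \<le> prox_fun \<rho>' g c y" if "y \<in> X" for y
    proof -
      have "0 \<le> (\<rho>' - \<rho>) / 2 * (norm (y - x))\<^sup>2" using rho_less by simp
      with prox_fun_growth[OF subdiff_g_weak[OF x(1) z(2)] that, of \<rho>' c] show ?thesis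
        unfolding d_def by linarith
    qed
    then have "\<zeta>g + d \<in> subdiff X (prox_fun \<rho>' g c) x"
      using prox_convex(2) by (simp add: subdiff_def convex_subdiff_def)
    with v(3) G0 have "(\<zeta>g + d) \<bullet> v \<le> - \<sigma>" by blast
    then have "\<gamma> * ((\<zeta>g + d) \<bullet> v) \<le> \<gamma> * (- \<sigma>)" using z(4) by (rule mult_left_mono)
    moreover have "v \<bullet> n \<le> 0" using v(1) nN unfolding dual_normal_cone_def by auto
    moreover have "v \<bullet> n = - (\<gamma>0 * ((\<zeta>f + d) \<bullet> v) + \<gamma> * ((\<zeta>g + d) \<bullet> v))"
      by (simp only: inner_commute[of v] n_def inner_minus_left inner_add_left[of "_ *\<^sub>R _"] inner_scaleR_left)
    ultimately have "\<gamma> * \<sigma> \<le> \<gamma>0 * ((\<zeta>f + d) \<bullet> v)" by linarith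
    also have "(\<zeta>f + d) \<bullet> v \<le> M + \<rho>' * D"
    proof -
      have "(\<zeta>f + d) \<bullet> v \<le> norm (\<zeta>f + d)" using norm_cauchy_schwarz[of "\<zeta>f + d" v] v(2) by simp
      with norm_triangle_ineq[of \<zeta>f d] M d_le show ?thesis by linarith
    qed
    then have "\<gamma>0 * ((\<zeta>f + d) \<bullet> v) \<le> \<gamma>0 * (M + \<rho>' * D)" using z(3) by (rule mult_left_mono)
    finally show ?thesis using \<open>\<sigma> > 0\<close> by (simp add: B pos_le_divide_eq)
  qed (use z B0 in simp)
  have "\<gamma>0 > 0" using bound z by (cases "\<gamma>0 = 0") auto
  define \<mu> where "\<mu> = \<gamma> / \<gamma>0"
  have \<mu>: "0 \<le> \<mu>" "\<mu> \<le> B" "\<mu> * \<gamma>0 = \<gamma>"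
    using z \<open>\<gamma>0 > 0\<close> bound by (auto simp: \<mu>_def pos_divide_le_eq mult.commute)
  define m where "m = (1 / \<gamma>0) *\<^sub>R n"
  have mN: "m \<in> normal_cone X x"
    using nN \<open>\<gamma>0 > 0\<close> by (auto simp: m_def normal_cone_def divide_nonpos_pos)
  have m_eq: "m = - ((\<zeta>f + d) + \<mu> *\<^sub>R (\<zeta>g + d))"
    using \<open>\<gamma>0 > 0\<close>
    by (simp add: m_def n_def \<mu>_def scaleR_right_distrib scaleR_right_diff_distrib)
  have le: "(1 + \<mu>) * (\<rho>' * norm (x - c)) \<le> \<epsilon>"
  proof -
    have "(1 + \<mu>) * (\<rho>' * norm (x - c)) \<le> (1 + B) * (\<rho>' * norm (x - c))"
      using \<mu>(2) rho'_gt_1 by (intro mult_right_mono) auto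
    with near show ?thesis by linarith
  qed
  have "\<zeta>f + \<mu> *\<^sub>R \<zeta>g - (- m) = - ((1 + \<mu>) *\<^sub>R d)"
    by (simp add: m_eq algebra_simps)
  then have "norm (\<zeta>f + \<mu> *\<^sub>R \<zeta>g - (- m)) = (1 + \<mu>) * (\<rho>' * norm (x - c))"
    using rho'_gt_1 \<mu>(1) by (simp add: d_def)
  then have "dist (\<zeta>f + \<mu> *\<^sub>R \<zeta>g) (- m) \<le> \<epsilon>"
    using le by (simp add: dist_norm)
  moreover have "- m \<in> uminus ` normal_cone X x" using mN by simp
  ultimately have "infdist (\<zeta>f + \<mu> *\<^sub>R \<zeta>g) (uminus ` normal_cone X x) \<le> \<epsilon>"
    by (rule infdist_le2[rotated])
  moreover have "\<bar>\<mu> * g x\<bar> \<le> \<epsilon>\<^sup>2"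
  proof -
    have "\<mu> * prox_fun \<rho>' g c x = 0" using slack by (auto simp: \<mu>_def)
    then have "\<mu> * g x = - (\<mu> * (\<rho>' / 2) * (norm (x - c))\<^sup>2)"
      unfolding prox_fun_def by (simp add: distrib_left mult.assoc)
    then have "\<bar>\<mu> * g x\<bar> = \<mu> * (\<rho>' / 2) * (norm (x - c))\<^sup>2"
      using \<mu>(1) rho'_gt_1 by (simp add: abs_mult)
    also have "\<dots> \<le> ((1 + \<mu>)\<^sup>2 * \<rho>'\<^sup>2) * (norm (x - c))\<^sup>2"
    proof (intro mult_right_mono mult_mono)
      show "\<mu> \<le> (1 + \<mu>)\<^sup>2" using \<mu>(1) by (simp add: power2_sum)
      show "\<rho>' / 2 \<le> \<rho>'\<^sup>2" using rho'_gt_1 self_le_power[of \<rho>' 2] by simp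
    qed (use rho'_gt_1 in auto)
    also have "\<dots> = ((1 + \<mu>) * (\<rho>' * norm (x - c)))\<^sup>2" by (simp add: power_mult_distrib)
    also have "\<dots> \<le> \<epsilon>\<^sup>2" using le \<mu>(1) rho'_gt_1 by (intro power_mono) auto
    finally show ?thesis .
  qed
  moreover have "g x \<le> 0"
  proof -
    have "0 \<le> \<rho>' / 2 * (norm (x - c))\<^sup>2" using rho'_gt_1 by simp
    with x(2) show ?thesis unfolding prox_fun_def by linarith
  qed
  ultimately show ?thesis unfolding KKT_point_def using x z \<mu>(1) by blast
qed

section \<open>Accuracy of the switching subgradient method\<close>

text \<open>The coefficient of the squared distance to the solution before step \<open>t\<close>. For positive \<open>t\<close> it is
  the weight \<open>t\<close> divided by the size of the preceding step; subtracting the gain \<open>(\<rho>' - \<rho>) * (t + 1)\<close>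
  from strong convexity turns the next coefficient into this one, so the estimates telescope.\<close>

definition ssm_energy :: "nat \<Rightarrow> real" where
  "ssm_energy t = (\<rho>' - \<rho>) * (real t * (real t + 1)) / 2 + 18 * \<rho>'\<^sup>2 / (\<rho>' - \<rho>)"

text \<open>The term \<open>36 * \<rho>'\<^sup>2 / ((\<rho>' - \<rho>) * (t + 1))\<close> in the step size serves the third bound, by the
  inequality of arithmetic and geometric means.\<close>

lemma pgssm_step_bounds:
  "0 < pgssm_step \<rho> \<rho>' t"
  "(real t + 1) * pgssm_step \<rho> \<rho>' t \<le> 2 / (\<rho>' - \<rho>)"
  "\<rho>' * pgssm_step \<rho> \<rho>' t \<le> 1 / 6"
  "(real t + 1) / pgssm_step \<rho> \<rho>' t = ssm_energy (Suc t)"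
proof -
  define \<mu> where "\<mu> = \<rho>' - \<rho>"
  define s where "s = \<mu> * (real t + 1)"
  define q where "q = \<mu> * (real t + 2) + 36 * \<rho>'\<^sup>2 / s"
  have \<mu>: "\<mu> > 0" using rho_less by (simp add: \<mu>_def)
  have s: "s > 0" using \<mu> by (simp add: s_def add_nonneg_pos)
  have \<alpha>: "pgssm_step \<rho> \<rho>' t = 2 / q"
    by (simp add: pgssm_step_def q_def s_def \<mu>_def)
  have e: "36 * \<rho>'\<^sup>2 / s \<ge> 0" using s by simp
  have sq: "s + 36 * \<rho>'\<^sup>2 / s \<le> q" using \<mu> by (simp add: q_def s_def algebra_simps)
  then have q: "q > 0" using s e by linarith
  show "0 < pgssm_step \<rho> \<rho>' t" using q by (simp add: \<alpha>)
  have "(real t + 1) * \<mu> \<le> q" using sq e by (simp add: s_def mult.commute)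
  then show "(real t + 1) * pgssm_step \<rho> \<rho>' t \<le> 2 / (\<rho>' - \<rho>)"
    unfolding \<alpha> \<mu>_def[symmetric] using q \<mu> by (simp add: field_simps)
  have "s + 36 * \<rho>'\<^sup>2 / s - 12 * \<rho>' = (s - 6 * \<rho>')\<^sup>2 / s"
    using s by (simp add: field_simps power2_eq_square)
  also have "\<dots> \<ge> 0" using s by simp
  finally have "12 * \<rho>' \<le> q" using sq by linarith
  then show "\<rho>' * pgssm_step \<rho> \<rho>' t \<le> 1 / 6"
    unfolding \<alpha> using q by (simp add: field_simps)
  have "(real t + 1) / pgssm_step \<rho> \<rho>' t = (real t + 1) * q / 2" by (simp add: \<alpha>)
  also have "\<dots> = \<mu> * ((real t + 1) * (real t + 2)) / 2 + (real t + 1) * (18 * \<rho>'\<^sup>2 / s)"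
    by (simp add: q_def field_simps)
  also have "(real t + 1) * (18 * \<rho>'\<^sup>2 / s) = 18 * \<rho>'\<^sup>2 / \<mu>"
    using \<mu> by (simp add: s_def)
  finally show "(real t + 1) / pgssm_step \<rho> \<rho>' t = ssm_energy (Suc t)"
    by (simp add: ssm_energy_def \<mu>_def add.commute)
qed

text \<open>The projection does not increase the distance to \<open>y\<close>; expanding the square and multiplying by
  the weight \<open>t + 1\<close> over the step size gives the telescoping form.\<close>

lemma projected_step_energy:
  assumes y: "y \<in> X"
    and growth: "H z + \<zeta> \<bullet> (y - z) + (\<rho>' - \<rho>) / 2 * (norm (y - z))\<^sup>2 \<le> H y"
    and z': "z' = closest_point X (z - pgssm_step \<rho> \<rho>' t *\<^sub>R \<zeta>)"
  shows "2 * (real t + 1) * (H z - H y) \<le> ssm_energy t * (norm (z - y))\<^sup>2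
    - ssm_energy (Suc t) * (norm (z' - y))\<^sup>2 + (real t + 1) * pgssm_step \<rho> \<rho>' t * (norm \<zeta>)\<^sup>2"
proof -
  define \<alpha> where "\<alpha> = pgssm_step \<rho> \<rho>' t"
  define w where "w = real t + 1"
  define q where "q = \<zeta> \<bullet> (z - y)"
  have \<alpha>: "\<alpha> > 0" and E: "w / \<alpha> = ssm_energy (Suc t)"
    using pgssm_step_bounds by (auto simp: \<alpha>_def w_def)
  have w: "w > 0" by (simp add: w_def add_nonneg_pos)
  have "norm (z' - y) \<le> norm (z - \<alpha> *\<^sub>R \<zeta> - y)"
    using closest_point_lipschitz[OF convex_X closed_X, of "z - \<alpha> *\<^sub>R \<zeta>" y] y closest_point_self[OF y]
    by (auto simp: dist_norm z' \<alpha>_def)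
  then have "(norm (z' - y))\<^sup>2 \<le> (norm (z - \<alpha> *\<^sub>R \<zeta> - y))\<^sup>2" by (intro power_mono) auto
  also have "\<dots> = (norm (z - y))\<^sup>2 - 2 * \<alpha> * q + \<alpha>\<^sup>2 * (norm \<zeta>)\<^sup>2"
    unfolding q_def power2_norm_eq_inner
    by (simp add: inner_diff_left inner_diff_right inner_commute power2_eq_square)
       (simp add: algebra_simps)
  finally have "w / \<alpha> * (norm (z' - y))\<^sup>2
      \<le> w / \<alpha> * ((norm (z - y))\<^sup>2 - 2 * \<alpha> * q + \<alpha>\<^sup>2 * (norm \<zeta>)\<^sup>2)"
    using w \<alpha> by (intro mult_left_mono) auto
  also have "\<dots> = w / \<alpha> * (norm (z - y))\<^sup>2 - 2 * w * q + w * \<alpha> * (norm \<zeta>)\<^sup>2"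
    using \<alpha> by (simp add: field_simps power2_eq_square)
  finally have 1: "w / \<alpha> * (norm (z' - y))\<^sup>2
      \<le> w / \<alpha> * (norm (z - y))\<^sup>2 - 2 * w * q + w * \<alpha> * (norm \<zeta>)\<^sup>2" .
  have "H z - H y + (\<rho>' - \<rho>) / 2 * (norm (z - y))\<^sup>2 \<le> q"
    using growth by (simp add: q_def inner_diff_right norm_minus_commute)
  then have "2 * w * (H z - H y + (\<rho>' - \<rho>) / 2 * (norm (z - y))\<^sup>2) \<le> 2 * w * q"
    using w by (intro mult_left_mono) auto
  then have 2: "2 * w * (H z - H y) + w * (\<rho>' - \<rho>) * (norm (z - y))\<^sup>2 \<le> 2 * w * q"
    by (simp add: field_simps)
  have 3: "ssm_energy t = w / \<alpha> - w * (\<rho>' - \<rho>)"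
  proof -
    have "k * ((u + 1) * (u + 2)) / 2 = k * (u * (u + 1)) / 2 + (u + 1) * k" for k u :: real
      by (simp add: field_simps)
    note eq = this[of "\<rho>' - \<rho>" "real t"]
    have "real (Suc t) * (real (Suc t) + 1) = (real t + 1) * (real t + 2)"
      by (simp add: add.commute)
    then have "ssm_energy (Suc t) = ssm_energy t + w * (\<rho>' - \<rho>)"
      unfolding ssm_energy_def w_def using eq by (simp only: add_ac)
    then show ?thesis unfolding E by simp
  qed
  have "ssm_energy t * (norm (z - y))\<^sup>2
      = w / \<alpha> * (norm (z - y))\<^sup>2 - w * (\<rho>' - \<rho>) * (norm (z - y))\<^sup>2"
    unfolding 3 by (simp add: left_diff_distrib)
  with 1 2 show ?thesis
    unfolding E[symmetric] \<alpha>_def[symmetric] w_def[symmetric] by linarith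
qed

text \<open>A subgradient of the subproblem is long only far from the centre, and there the value of the
  proximal constraint is large.\<close>

lemma prox_subgradient_bound:
  assumes "z \<in> X" "norm \<xi> \<le> M"
  shows "(norm (\<xi> + \<rho>' *\<^sub>R (z - c)))\<^sup>2 \<le> 2 * M\<^sup>2 - 4 * \<rho>' * glb + 4 * \<rho>' * prox_fun \<rho>' g c z"
proof -
  have "(norm (\<xi> + \<rho>' *\<^sub>R (z - c)))\<^sup>2 \<le> (norm \<xi> + norm (\<rho>' *\<^sub>R (z - c)))\<^sup>2"
    by (intro power_mono norm_triangle_ineq norm_ge_zero)
  also have "\<dots> \<le> 2 * (norm \<xi>)\<^sup>2 + 2 * (norm (\<rho>' *\<^sub>R (z - c)))\<^sup>2"
    using sum_squares_bound[of "norm \<xi>" "norm (\<rho>' *\<^sub>R (z - c))"] by (simp add: power2_sum)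
  also have "\<dots> \<le> 2 * M\<^sup>2 + 2 * (norm (\<rho>' *\<^sub>R (z - c)))\<^sup>2"
    using assms(2) by (simp add: power_mono)
  also have "(norm (\<rho>' *\<^sub>R (z - c)))\<^sup>2 = \<rho>' * (\<rho>' * (norm (z - c))\<^sup>2)"
    by (simp add: power_mult_distrib power2_eq_square)
  also have "2 * M\<^sup>2 + 2 * (\<rho>' * (\<rho>' * (norm (z - c))\<^sup>2))
      = 2 * M\<^sup>2 - 4 * \<rho>' * g z + 4 * \<rho>' * prox_fun \<rho>' g c z"
    by (simp add: prox_fun_def algebra_simps)
  also have "\<dots> \<le> 2 * M\<^sup>2 - 4 * \<rho>' * glb + 4 * \<rho>' * prox_fun \<rho>' g c z"
    using glb_le[OF assms(1)] rho'_gt_1 by simp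
  finally show ?thesis .
qed

text \<open>Let \<open>I\<close> be the set of steps with constraint value at most \<open>\<tau>\<close>. Summing the energy estimates
  shows that the excess of the objective over \<open>F y + \<tau>\<close>, weighted and summed over \<open>I\<close>, is negative: a
  step outside \<open>I\<close> starts from a point with constraint value above \<open>\<tau>\<close>, so it makes at least the
  progress of a step in \<open>I\<close> with excess \<open>0\<close>. In particular \<open>I\<close> is nonempty, and the convexity of the subproblem carries the estimate over to
  the weighted average.\<close>

lemma ssm_output_accuracy:
  fixes c :: 'a
  defines "F \<equiv> prox_fun \<rho>' f c" and "G \<equiv> prox_fun \<rho>' g c"
  assumes run: "ssm_run X F G \<tau> T c (pgssm_step \<rho> \<rho>') z \<zeta>"
    and subgrad: "\<And>t. t < T \<Longrightarrow> \<exists>\<xi>. \<xi> \<in> subdiff X (if G (z t) \<le> \<tau> then f else g) (z t)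
      \<and> norm \<xi> \<le> M \<and> \<zeta> t = \<xi> + \<rho>' *\<^sub>R (z t - c)"
    and c: "c \<in> X" and y: "y \<in> X" "G y \<le> 0" "(norm (y - c))\<^sup>2 \<le> D2"
    and "glb \<le> 0" "\<tau> > 0" "T > 0"
    and T1: "24 * (3 * M\<^sup>2 - 2 * \<rho>' * glb) \<le> (\<rho>' - \<rho>) * \<tau> * real T"
    and T2: "72 * \<rho>'\<^sup>2 * D2 \<le> (\<rho>' - \<rho>) * \<tau> * (real T)\<^sup>2"
  shows "ssm_output G \<tau> T z \<in> X" "G (ssm_output G \<tau> T z) \<le> \<tau>"
    "F (ssm_output G \<tau> T z) \<le> F y + \<tau>"
proof -
  define I where "I = {t. t < T \<and> G (z t) \<le> \<tau>}"
  define L where "L = 2 * M\<^sup>2 - 4 * \<rho>' * glb"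
  define \<mu> where "\<mu> = \<rho>' - \<rho>"
  have \<mu>: "\<mu> > 0" using rho_less by (simp add: \<mu>_def)
  have "\<rho>' * glb \<le> 0" using \<open>glb \<le> 0\<close> rho'_gt_1 by (simp add: mult_nonneg_nonpos)
  moreover have "0 \<le> M\<^sup>2" by simp
  ultimately have L0: "L \<ge> 0" unfolding L_def by linarith
  have zX: "z t \<in> X" if "t \<le> T" for t
    using that run c closest_point_in_set[OF closed_X] unfolding ssm_run_def
    by (cases t) (auto simp: Suc_le_eq)
  \<comment> \<open>With the value \<open>0\<close> outside \<open>I\<close>, both kinds of steps satisfy the same estimate.\<close>
  define e where "e t = (if t \<in> I then F (z t) - F y - \<tau> else 0)" for t
  define P where "P t = ssm_energy t * (norm (z t - y))\<^sup>2" for t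
  have step: "2 * ((real t + 1) * e t) + 4 / 3 * \<tau> * (real t + 1) \<le> P t - P (Suc t) + 2 * L / \<mu>"
    if t: "t < T" for t
  proof -
    define \<alpha> where "\<alpha> = pgssm_step \<rho> \<rho>' t"
    define w where "w = real t + 1"
    have w: "w > 0" by (simp add: w_def add_nonneg_pos)
    have \<alpha>: "\<alpha> > 0" "w * \<alpha> \<le> 2 / \<mu>" "\<rho>' * \<alpha> \<le> 1 / 6"
      using pgssm_step_bounds by (auto simp: \<alpha>_def w_def \<mu>_def)
    have ztX: "z t \<in> X" using zX t by simp
    from subgrad[OF t] obtain \<xi> where \<xi>: "\<xi> \<in> subdiff X (if G (z t) \<le> \<tau> then f else g) (z t)"
      "norm \<xi> \<le> M" "\<zeta> t = \<xi> + \<rho>' *\<^sub>R (z t - c)" by blast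
    have z': "z (Suc t) = closest_point X (z t - pgssm_step \<rho> \<rho>' t *\<^sub>R \<zeta> t)"
      using run t unfolding ssm_run_def by blast
    have bound: "w * \<alpha> * (norm (\<zeta> t))\<^sup>2 \<le> 2 * L / \<mu> + 2 / 3 * (w * m)"
      if m: "G (z t) \<le> m" "0 \<le> m" for m
    proof -
      have "(norm (\<zeta> t))\<^sup>2 \<le> L + 4 * \<rho>' * m"
      proof -
        have "4 * \<rho>' * G (z t) \<le> 4 * \<rho>' * m"
          using m(1) rho'_gt_1 by (intro mult_left_mono) auto
        with prox_subgradient_bound[OF ztX \<xi>(2), of c] show ?thesis
          unfolding \<xi>(3) L_def G_def by linarith
      qed
      then have "w * \<alpha> * (norm (\<zeta> t))\<^sup>2 \<le> w * \<alpha> * (L + 4 * \<rho>' * m)"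
        using w \<alpha> by (intro mult_left_mono) auto
      also have "\<dots> = w * \<alpha> * L + \<rho>' * \<alpha> * (4 * (w * m))" by (simp add: algebra_simps)
      also have "\<dots> \<le> 2 / \<mu> * L + 1 / 6 * (4 * (w * m))"
        using \<alpha> L0 w m(2) by (intro add_mono mult_right_mono) auto
      finally show ?thesis by (simp add: mult.commute)
    qed
    show ?thesis
    proof (cases "t \<in> I")
      case True
      then have Gz: "G (z t) \<le> \<tau>" by (simp add: I_def)
      have "\<xi> \<in> weak_subdiff \<rho> X f (z t)" using \<xi>(1) Gz subdiff_f_weak[OF ztX] by simp
      from prox_fun_growth[OF this y(1), of \<rho>' c]
      have "F (z t) + \<zeta> t \<bullet> (y - z t) + (\<rho>' - \<rho>) / 2 * (norm (y - z t))\<^sup>2 \<le> F y"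
        unfolding F_def \<xi>(3) .
      from projected_step_energy[where H = F, OF y(1) this z']
      have "2 * w * (F (z t) - F y) \<le> P t - P (Suc t) + w * \<alpha> * (norm (\<zeta> t))\<^sup>2"
        unfolding P_def w_def \<alpha>_def by simp
      with bound[OF Gz] \<open>\<tau> > 0\<close>
      have "2 * w * (F (z t) - F y) \<le> P t - P (Suc t) + 2 * L / \<mu> + 2 / 3 * (w * \<tau>)" by simp
      then show ?thesis using True unfolding e_def w_def[symmetric] by (simp add: algebra_simps)
    next
      case False
      then have Gz: "\<not> G (z t) \<le> \<tau>" using t by (simp add: I_def)
      have "\<xi> \<in> weak_subdiff \<rho> X g (z t)" using \<xi>(1) Gz subdiff_g_weak[OF ztX] by simp
      from prox_fun_growth[OF this y(1), of \<rho>' c]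
      have "G (z t) + \<zeta> t \<bullet> (y - z t) + (\<rho>' - \<rho>) / 2 * (norm (y - z t))\<^sup>2 \<le> G y"
        unfolding G_def \<xi>(3) .
      from projected_step_energy[where H = G, OF y(1) this z']
      have "2 * w * (G (z t) - G y) \<le> P t - P (Suc t) + w * \<alpha> * (norm (\<zeta> t))\<^sup>2"
        unfolding P_def w_def \<alpha>_def by simp
      moreover have "w * \<alpha> * (norm (\<zeta> t))\<^sup>2 \<le> 2 * L / \<mu> + 2 / 3 * (w * G (z t))"
        using bound[of "G (z t)"] Gz \<open>\<tau> > 0\<close> by simp
      moreover have "w * G (z t) \<ge> w * \<tau>" "w * G y \<le> 0"
        using Gz w y(2) by (auto simp: mult_nonneg_nonpos)
      ultimately have "4 / 3 * (w * \<tau>) \<le> P t - P (Suc t) + 2 * L / \<mu>"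
        by (simp add: right_diff_distrib)
      then show ?thesis using False unfolding e_def w_def[symmetric] by (simp add: mult_ac)
    qed
  qed
  define W where "W = (\<Sum>t<T. real t + 1)"
  have W: "2 * W \<ge> (real T)\<^sup>2"
    unfolding W_def by (induction T) (simp_all add: power2_eq_square algebra_simps)
  have "(\<Sum>t<T. 2 * ((real t + 1) * e t) + 4 / 3 * \<tau> * (real t + 1))
      \<le> (\<Sum>t<T. P t - P (Suc t) + 2 * L / \<mu>)"
    by (intro sum_mono step) simp
  also have "\<dots> = P 0 - P T + real T * (2 * L / \<mu>)"
    by (simp only: sum.distrib sum_lessThan_telescope' sum_constant card_lessThan)
  also have "(\<Sum>t<T. 2 * ((real t + 1) * e t) + 4 / 3 * \<tau> * (real t + 1))
      = 2 * (\<Sum>t<T. (real t + 1) * e t) + 4 / 3 * \<tau> * W"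
    by (subst sum.distrib) (simp only: sum_distrib_left W_def)
  finally have total: "2 * (\<Sum>t<T. (real t + 1) * e t) + 4 / 3 * \<tau> * W
      \<le> P 0 - P T + real T * (2 * L / \<mu>)" .
  have "P T \<ge> 0" using \<mu> by (simp add: P_def ssm_energy_def \<mu>_def)
  have P0: "P 0 \<le> \<tau> * (real T)\<^sup>2 / 4"
  proof -
    have "z 0 = c" using run by (simp add: ssm_run_def)
    then have "P 0 = 18 * \<rho>'\<^sup>2 / \<mu> * (norm (y - c))\<^sup>2"
      by (simp add: P_def ssm_energy_def \<mu>_def norm_minus_commute)
    also have "\<dots> \<le> 18 * \<rho>'\<^sup>2 / \<mu> * D2" using y(3) \<mu> by (intro mult_left_mono) auto
    also have "\<dots> \<le> \<tau> * (real T)\<^sup>2 / 4"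
      using T2 \<mu> unfolding \<mu>_def[symmetric] by (simp add: field_simps)
    finally show ?thesis .
  qed
  have TL: "real T * (2 * L / \<mu>) \<le> \<tau> * (real T)\<^sup>2 / 6"
  proof -
    have "L \<le> 2 * (3 * M\<^sup>2 - 2 * \<rho>' * glb)" by (simp add: L_def)
    then have "12 * L \<le> \<mu> * \<tau> * real T" using T1 unfolding \<mu>_def by linarith
    then have "2 * L / \<mu> \<le> \<tau> * real T / 6" using \<mu> by (simp add: field_simps)
    then have "real T * (2 * L / \<mu>) \<le> real T * (\<tau> * real T / 6)" by (intro mult_left_mono) auto
    then show ?thesis by (simp add: power2_eq_square mult_ac)
  qed
  have \<tau>W: "4 / 3 * \<tau> * W \<ge> 2 / 3 * (\<tau> * (real T)\<^sup>2)"
    using mult_left_mono[OF W, of "2 / 3 * \<tau>"] \<open>\<tau> > 0\<close> by simp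
  have "0 < \<tau> * (real T)\<^sup>2" using \<open>\<tau> > 0\<close> \<open>T > 0\<close> by simp
  with total \<open>P T \<ge> 0\<close> P0 TL \<tau>W have neg: "(\<Sum>t<T. (real t + 1) * e t) < 0" by linarith
  have fin: "finite I" by (simp add: I_def)
  have "(\<Sum>t<T. (real t + 1) * e t) = (\<Sum>t\<in>I. (real t + 1) * e t)"
    by (rule sum.mono_neutral_right) (auto simp: I_def e_def)
  also have "\<dots> = (\<Sum>t\<in>I. (real t + 1) * (F (z t) - F y - \<tau>))"
    by (rule sum.cong) (auto simp: e_def)
  finally have negI: "(\<Sum>t\<in>I. (real t + 1) * (F (z t) - F y - \<tau>)) < 0" using neg by simp
  then have "I \<noteq> {}" by auto
  define V where "V = (\<Sum>t\<in>I. real t + 1)"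
  have "V > 0" unfolding V_def using fin \<open>I \<noteq> {}\<close> by (intro sum_pos) (auto intro: add_nonneg_pos)
  define a where "a t = (real t + 1) / V" for t
  have a: "sum a I = 1" "\<And>t. t \<in> I \<Longrightarrow> a t \<ge> 0"
    using \<open>V > 0\<close> by (auto simp: a_def sum_divide_distrib[symmetric] V_def[symmetric])
  have zI: "z t \<in> X" if "t \<in> I" for t using that zX by (simp add: I_def)
  have out: "ssm_output G \<tau> T z = (\<Sum>t\<in>I. a t *\<^sub>R z t)"
    unfolding ssm_output_def I_def[symmetric] Let_def
    by (simp add: scaleR_sum_right a_def V_def divide_inverse_commute add.commute)
  show "ssm_output G \<tau> T z \<in> X"
    unfolding out using convex_sum[OF fin convex_X a(1)] a(2) zI by blast
  have "G (ssm_output G \<tau> T z) \<le> (\<Sum>t\<in>I. a t * G (z t))"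
    unfolding out using a zI
    by (intro convex_on_sum[OF fin \<open>I \<noteq> {}\<close> prox_convex(2)[of c, folded G_def]]) auto
  also have "\<dots> \<le> (\<Sum>t\<in>I. a t * \<tau>)"
    using a by (intro sum_mono mult_left_mono) (auto simp: I_def)
  also have "\<dots> = \<tau>" by (simp add: sum_distrib_right[symmetric] a)
  finally show "G (ssm_output G \<tau> T z) \<le> \<tau>" .
  have "F (ssm_output G \<tau> T z) \<le> (\<Sum>t\<in>I. a t * F (z t))"
    unfolding out using a zI
    by (intro convex_on_sum[OF fin \<open>I \<noteq> {}\<close> prox_convex(1)[of c, folded F_def]]) auto
  also have "\<dots> = (\<Sum>t\<in>I. a t * (F (z t) - F y - \<tau>)) + (\<Sum>t\<in>I. a t * (F y + \<tau>))"
    by (simp add: sum.distrib[symmetric] algebra_simps)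
  also have "(\<Sum>t\<in>I. a t * (F y + \<tau>)) = F y + \<tau>" by (simp add: sum_distrib_right[symmetric] a)
  also have "(\<Sum>t\<in>I. a t * (F (z t) - F y - \<tau>)) = (\<Sum>t\<in>I. (real t + 1) * (F (z t) - F y - \<tau>)) / V"
    by (simp add: a_def sum_divide_distrib)
  also have "\<dots> \<le> 0" using negI \<open>V > 0\<close> by (simp add: divide_nonpos_pos)
  finally show "F (ssm_output G \<tau> T z) \<le> F y + \<tau>" by simp
qed

section \<open>Feasibility of the iterates\<close>

text \<open>The Lagrangian of the subproblem is strongly convex and minimal at the solution, so a
  nearly optimal and nearly feasible point is near the solution.\<close>

lemma near_prox_solution_if_accurate:
  assumes opt: "optimal_solution X (prox_fun \<rho>' f c) (prox_fun \<rho>' g c) x" and w: "w \<in> X"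
    and accurate: "prox_fun \<rho>' f c w \<le> prox_fun \<rho>' f c x + \<tau>" "prox_fun \<rho>' g c w \<le> \<tau>"
  shows "(\<rho>' - \<rho>) / 2 * (norm (w - x))\<^sup>2 \<le> \<tau>"
proof -
  have x: "x \<in> X" using opt unfolding optimal_solution_def is_arg_min_def by auto
  obtain \<zeta>f \<zeta>g \<gamma>0 \<gamma> where z: "\<zeta>f \<in> subdiff X f x" "\<zeta>g \<in> subdiff X g x" "\<gamma>0 \<ge> 0" "\<gamma> \<ge> 0" "\<gamma>0 + \<gamma> = 1"
    and slack: "\<gamma> * prox_fun \<rho>' g c x = 0"
    and normal: "- (\<gamma>0 *\<^sub>R (\<zeta>f + \<rho>' *\<^sub>R (x - c)) + \<gamma> *\<^sub>R (\<zeta>g + \<rho>' *\<^sub>R (x - c))) \<in> normal_cone X x"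
    using prox_subproblem_fritz_john[OF opt] by blast
  define q where "q = (\<rho>' - \<rho>) / 2 * (norm (w - x))\<^sup>2"
  define a where "a = (\<zeta>f + \<rho>' *\<^sub>R (x - c)) \<bullet> (w - x)"
  define b where "b = (\<zeta>g + \<rho>' *\<^sub>R (x - c)) \<bullet> (w - x)"
  have "a + q \<le> \<tau>"
    using prox_fun_growth[OF subdiff_f_weak[OF x z(1)] w, of \<rho>' c] accurate(1)
    unfolding a_def q_def by linarith
  then have 1: "\<gamma>0 * (a + q) \<le> \<gamma>0 * \<tau>" using z(3) by (rule mult_left_mono)
  have "prox_fun \<rho>' g c x + b + q \<le> \<tau>"
    using prox_fun_growth[OF subdiff_g_weak[OF x z(2)] w, of \<rho>' c] accurate(2)
    unfolding b_def q_def by linarith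
  then have "\<gamma> * (prox_fun \<rho>' g c x + b + q) \<le> \<gamma> * \<tau>" using z(4) by (rule mult_left_mono)
  then have 2: "\<gamma> * (b + q) \<le> \<gamma> * \<tau>" using slack by (simp add: distrib_left)
  have "0 \<le> (\<gamma>0 *\<^sub>R (\<zeta>f + \<rho>' *\<^sub>R (x - c)) + \<gamma> *\<^sub>R (\<zeta>g + \<rho>' *\<^sub>R (x - c))) \<bullet> (w - x)"
    using normal w unfolding normal_cone_def by (simp only: mem_Collect_eq inner_minus_left) auto
  then have 3: "0 \<le> \<gamma>0 * a + \<gamma> * b"
    unfolding a_def b_def by (simp only: inner_add_left inner_scaleR_left)
  have "(\<gamma>0 + \<gamma>) * q \<le> (\<gamma>0 + \<gamma>) * \<tau>" using 1 2 3 by (simp add: algebra_simps)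
  then show ?thesis unfolding q_def z(5) by simp
qed

text \<open>With \<open>\<tau>\<close> of this size, \<open>w\<close> being near the solution forces it away from \<open>c\<close>, and the
  proximal term exceeds the error \<open>\<tau>\<close> of the constraint. The weights in Young's inequality are
  the two curvatures \<open>\<rho>' - \<rho>\<close> and \<open>\<rho>'\<close>.\<close>

lemma feasible_if_solution_far:
  fixes w x c :: 'a
  assumes near: "(\<rho>' - \<rho>) / 2 * (norm (w - x))\<^sup>2 \<le> \<tau>" and accurate: "prox_fun \<rho>' g c w \<le> \<tau>"
    and far: "\<epsilon> < \<rho>' * norm (x - c)" and "\<epsilon> > 0"
    and \<tau>: "\<tau> = (\<rho>' - \<rho>) * \<epsilon>\<^sup>2 / (4 * \<rho>' * (2 * \<rho>' - \<rho>))"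
  shows "g w \<le> 0"
proof (rule ccontr)
  assume "\<not> ?thesis"
  define s where "s = \<rho>' - \<rho>"
  have s: "s > 0" using rho_less by (simp add: s_def)
  have r: "\<rho>' > 0" using rho'_gt_1 by simp
  define b where "b = norm (w - x)"
  define d where "d = norm (w - c)"
  have d2: "\<rho>' * d\<^sup>2 \<le> 2 * \<tau>"
    using accurate \<open>\<not> g w \<le> 0\<close> by (simp add: prox_fun_def d_def)
  have b2: "s * b\<^sup>2 \<le> 2 * \<tau>" using near by (simp add: s_def b_def)
  have "norm (x - c) \<le> b + d"
    using norm_triangle_ineq[of "x - w" "w - c"] by (simp add: b_def d_def norm_minus_commute)
  then have "(\<rho>' * norm (x - c))\<^sup>2 \<le> (\<rho>' * (b + d))\<^sup>2"
    using r by (intro power_mono mult_left_mono) auto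
  moreover have "\<epsilon>\<^sup>2 < (\<rho>' * norm (x - c))\<^sup>2"
    using far \<open>\<epsilon> > 0\<close> by (intro power_strict_mono) auto
  ultimately have "\<epsilon>\<^sup>2 < (\<rho>' * (b + d))\<^sup>2" by linarith
  then have "s * \<epsilon>\<^sup>2 < s * (\<rho>' * (b + d))\<^sup>2" using s by simp
  also have "\<dots> = \<rho>' * (\<rho>' * s * (b + d)\<^sup>2)" by (simp add: power2_eq_square mult_ac)
  also have "\<rho>' * s * (b + d)\<^sup>2 \<le> (s + \<rho>') * (s * b\<^sup>2 + \<rho>' * d\<^sup>2)"
  proof -
    have "(s + \<rho>') * (s * b\<^sup>2 + \<rho>' * d\<^sup>2) - \<rho>' * s * (b + d)\<^sup>2 = (s * b - \<rho>' * d)\<^sup>2"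
      by (simp add: power2_eq_square algebra_simps)
    then show ?thesis by (metis diff_ge_0_iff_ge zero_le_power2)
  qed
  also have "(s + \<rho>') * (s * b\<^sup>2 + \<rho>' * d\<^sup>2) \<le> (s + \<rho>') * (4 * \<tau>)"
    using b2 d2 s r by (intro mult_left_mono) auto
  also have "\<rho>' * ((s + \<rho>') * (4 * \<tau>)) = s * \<epsilon>\<^sup>2"
  proof -
    define N where "N = s + \<rho>'"
    have "2 * \<rho>' - \<rho> = N" by (simp add: s_def N_def)
    then have "\<tau> = s * \<epsilon>\<^sup>2 / (4 * \<rho>' * N)" unfolding \<tau> by (simp add: s_def)
    moreover have "N > 0" using s r by (simp add: N_def)
    ultimately show ?thesis unfolding N_def[symmetric] using r by (simp add: field_simps)
  qed
  finally show False using r by (simp add: mult_left_mono)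
qed

text \<open>The lower bounds on \<open>T\<close> are \<open>24 * (3 * M\<^sup>2 - 2 * \<rho>' * glb) / ((\<rho>' - \<rho>) * \<tau>)\<close> and the square root of
  \<open>72 * \<rho>'\<^sup>2 * D\<^sup>2 / ((\<rho>' - \<rho>) * \<tau>)\<close>, which is what the accuracy \<open>\<tau>\<close> of the inner method requires.\<close>

lemma pgssm_iterates_feasible:
  assumes run: "pgssm_run X f g M \<rho> \<rho>' \<tau> T x0 x" and x0: "x0 \<in> X" "g x0 \<le> 0"
    and "\<epsilon> > 0" and \<tau>: "\<tau> = (\<rho>' - \<rho>) * \<epsilon>\<^sup>2 / (4 * \<rho>' * (2 * \<rho>' - \<rho>))"
    and D: "D = sqrt ((- 8 * glb) / (\<rho>' - \<rho>))"
    and T: "T = nat \<lceil>max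
      (96 * \<rho>' * (2 * \<rho>' - \<rho>) * (3 * M\<^sup>2 - 2 * \<rho>' * glb) / ((\<rho>' - \<rho>)\<^sup>2 * \<epsilon>\<^sup>2))
      (sqrt (288 * \<rho>' ^ 3 * (2 * \<rho>' - \<rho>) * D\<^sup>2 / ((\<rho>' - \<rho>)\<^sup>2 * \<epsilon>\<^sup>2)))\<rceil>"
    and far: "\<And>j y. j < k \<Longrightarrow> optimal_solution X (prox_fun \<rho>' f (x j)) (prox_fun \<rho>' g (x j)) y
      \<Longrightarrow> g (x j) \<le> 0 \<Longrightarrow> \<epsilon> < \<rho>' * norm (y - x j)"
  shows "x k \<in> X \<and> g (x k) \<le> 0"
proof -
  define \<mu> where "\<mu> = \<rho>' - \<rho>"
  define N where "N = 2 * \<rho>' - \<rho>"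
  have pos: "\<mu> > 0" "\<rho>' > 0" "N > 0" using rho_less rho'_gt_1 by (auto simp: \<mu>_def N_def)
  have \<tau>': "\<tau> = \<mu> * \<epsilon>\<^sup>2 / (4 * \<rho>' * N)" by (simp add: \<tau> \<mu>_def N_def)
  have "\<tau> > 0" using pos \<open>\<epsilon> > 0\<close> by (simp add: \<tau>')
  have glb0: "glb \<le> 0" using glb_le[OF x0(1)] x0(2) by linarith
  have D2: "D\<^sup>2 = (- 8 * glb) / (\<rho>' - \<rho>)" unfolding D
    by (intro real_sqrt_pow2 divide_nonneg_pos) (use glb0 rho_less in auto)
  define A where "A = 3 * M\<^sup>2 - 2 * \<rho>' * glb"
  have "A > 0"
  proof -
    have "\<rho>' * glb \<le> 0" using glb0 pos by (simp add: mult_nonneg_nonpos)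
    moreover have "0 < M\<^sup>2" using M_pos by simp
    ultimately show ?thesis unfolding A_def by linarith
  qed
  define p where "p = 96 * \<rho>' * N * A / (\<mu>\<^sup>2 * \<epsilon>\<^sup>2)"
  define q where "q = 288 * \<rho>' ^ 3 * N * D\<^sup>2 / (\<mu>\<^sup>2 * \<epsilon>\<^sup>2)"
  have T': "T = nat \<lceil>max p (sqrt q)\<rceil>" by (simp add: T p_def q_def A_def N_def \<mu>_def)
  have p: "p > 0" "\<mu> * \<tau> * p = 24 * A"
    using pos \<open>\<epsilon> > 0\<close> \<open>A > 0\<close> by (auto simp: p_def \<tau>' field_simps power2_eq_square)
  have q: "q \<ge> 0" using pos by (simp add: q_def)
  have q_eq: "\<mu> * \<tau> * q = 72 * \<rho>'\<^sup>2 * D\<^sup>2"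
    using pos \<open>\<epsilon> > 0\<close> by (auto simp: q_def \<tau>' field_simps power2_eq_square power3_eq_cube)
  have le: "p \<le> real T" "sqrt q \<le> real T" unfolding T' by linarith+
  have T0: "T > 0" using p(1) le(1) by (cases T) auto
  have T1: "24 * A \<le> (\<rho>' - \<rho>) * \<tau> * real T"
    using mult_left_mono[OF le(1), of "\<mu> * \<tau>"] pos \<open>\<tau> > 0\<close> p(2) by (simp add: \<mu>_def)
  have "q \<le> (real T)\<^sup>2" using power_mono[OF le(2), of 2] q by simp
  then have T2: "72 * \<rho>'\<^sup>2 * D\<^sup>2 \<le> (\<rho>' - \<rho>) * \<tau> * (real T)\<^sup>2"
    using mult_left_mono[of q "(real T)\<^sup>2" "\<mu> * \<tau>"] pos \<open>\<tau> > 0\<close> q_eq by (simp add: \<mu>_def)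
  show ?thesis
    using far
  proof (induction k)
    case 0
    then show ?case using run x0 by (simp add: pgssm_run_def)
  next
    case (Suc k)
    have IH: "x k \<in> X" "g (x k) \<le> 0" using Suc.IH Suc.prems by (auto simp: less_Suc_eq)
    obtain y where y: "optimal_solution X (prox_fun \<rho>' f (x k)) (prox_fun \<rho>' g (x k)) y"
      using prox_subproblem_has_solution[OF closed_X f(1) f_bdd g(1) pos(2) IH] by blast
    have yX: "y \<in> X" "prox_fun \<rho>' g (x k) y \<le> 0"
      using y unfolding optimal_solution_def is_arg_min_def by auto
    have yD: "(norm (y - x k))\<^sup>2 \<le> D\<^sup>2" unfolding D2 using prox_feasible_near[OF yX] .
    from run obtain z \<zeta> where z: "ssm_run X (prox_fun \<rho>' f (x k)) (prox_fun \<rho>' g (x k)) \<tau> T (x k)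
        (pgssm_step \<rho> \<rho>') z \<zeta>"
      "\<And>t. t < T \<Longrightarrow> \<exists>\<xi>. \<xi> \<in> subdiff X (if prox_fun \<rho>' g (x k) (z t) \<le> \<tau> then f else g) (z t)
        \<and> norm \<xi> \<le> M \<and> \<zeta> t = \<xi> + \<rho>' *\<^sub>R (z t - x k)"
      "x (Suc k) = ssm_output (prox_fun \<rho>' g (x k)) \<tau> T z"
      unfolding pgssm_run_def by blast
    note acc = ssm_output_accuracy[OF z(1,2) IH(1) yX yD glb0 \<open>\<tau> > 0\<close> T0 T1[unfolded A_def] T2,
      folded z(3)]
    have "g (x (Suc k)) \<le> 0"
      by (rule feasible_if_solution_far[OF near_prox_solution_if_accurate[OF y acc(1,3,2)] acc(2)
            Suc.prems[OF lessI y IH(2)] \<open>\<epsilon> > 0\<close> \<tau>])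
    with acc(1) show ?case by simp
  qed
qed

end

theorem lemma3p5:
  fixes X :: "'a::euclidean_space set" and f g :: "'a \<Rightarrow> real"
    and \<rho> \<rho>' M \<epsilon> glb D :: real and x0 :: 'a
  assumes "closed X" and "convex X" and "\<rho> \<ge> 0" and "M > 0"
    and A: "continuous_on X f" "continuous_on X g"
           "weakly_convex_on \<rho> X f" "weakly_convex_on \<rho> X g"
    and B: "bdd_below (f ` X)" "bdd_below (g ` X)"
    and C: "\<And>x. x \<in> X \<Longrightarrow> (\<exists>\<zeta>f\<in>subdiff X f x. norm \<zeta>f \<le> M) \<and> (\<exists>\<zeta>g\<in>subdiff X g x. norm \<zeta>g \<le> M)"
    and D: "x0 \<in> X" "g x0 \<le> 0"
    and "\<rho>' > max \<rho> 1" and "\<epsilon> > 0"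
    and "glb = (INF x\<in>X. g x)" and "D = sqrt ((- 8 * glb) / (\<rho>' - \<rho>))"
  shows
    "(\<forall>\<tau> T x.
        \<tau> = (\<rho>' - \<rho>) * \<epsilon>\<^sup>2 / (4 * \<rho>' * (2 * \<rho>' - \<rho>)) \<longrightarrow>
        T = nat \<lceil>max
              (96 * \<rho>' * (2 * \<rho>' - \<rho>) * (3 * M\<^sup>2 - 2 * \<rho>' * glb) / ((\<rho>' - \<rho>)\<^sup>2 * \<epsilon>\<^sup>2))
              (sqrt (288 * \<rho>' ^ 3 * (2 * \<rho>' - \<rho>) * D\<^sup>2 / ((\<rho>' - \<rho>)\<^sup>2 * \<epsilon>\<^sup>2)))\<rceil> \<longrightarrow>
        pgssm_run X f g M \<rho> \<rho>' \<tau> T x0 x \<longrightarrow>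
        (\<forall>k. \<not> (\<exists>j\<le>k. \<exists>xhat.
                  optimal_solution X (prox_fun \<rho>' f (x j)) (prox_fun \<rho>' g (x j)) xhat \<and>
                  FJ_point \<epsilon> X f g xhat) \<longrightarrow>
             g (x k) \<le> 0))
     \<and>
     (\<forall>\<sigma> B \<tau> T x.
        \<sigma> > 0 \<longrightarrow>
        B = (M + \<rho>' * D) / \<sigma> \<longrightarrow>
        \<tau> = (\<rho>' - \<rho>) * \<epsilon>\<^sup>2 / (4 * (1 + B)\<^sup>2 * \<rho>' * (2 * \<rho>' - \<rho>)) \<longrightarrow>
        T = nat \<lceil>max
              (96 * (1 + B)\<^sup>2 * \<rho>' * (2 * \<rho>' - \<rho>) * (3 * M\<^sup>2 - 2 * \<rho>' * glb) / ((\<rho>' - \<rho>)\<^sup>2 * \<epsilon>\<^sup>2))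
              (sqrt (288 * (1 + B)\<^sup>2 * \<rho>' ^ 3 * (2 * \<rho>' - \<rho>) * D\<^sup>2 / ((\<rho>' - \<rho>)\<^sup>2 * \<epsilon>\<^sup>2)))\<rceil> \<longrightarrow>
        pgssm_run X f g M \<rho> \<rho>' \<tau> T x0 x \<longrightarrow>
        (\<forall>k. strong_MFCQ \<sigma> X (prox_fun \<rho>' g (x k))) \<longrightarrow>
        (\<forall>k. \<not> (\<exists>j\<le>k. \<exists>xhat.
                  optimal_solution X (prox_fun \<rho>' f (x j)) (prox_fun \<rho>' g (x j)) xhat \<and>
                  KKT_point \<epsilon> X f g xhat) \<longrightarrow>
             g (x k) \<le> 0))"
proof -
  note glb = assms(16) and D_eq = assms(17)
  have "weakly_convex_problem X f g \<rho> \<rho>' M glb"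
  proof
    show "glb \<le> g x" if "x \<in> X" for x unfolding glb using B(2) that by (rule cINF_lower)
    show "\<exists>\<zeta>\<in>subdiff X f x. norm \<zeta> \<le> M" "\<exists>\<zeta>\<in>subdiff X g x. norm \<zeta> \<le> M" if "x \<in> X" for x
      using C[OF that] by blast+
    show "\<rho> < \<rho>'" "1 < \<rho>'" using \<open>\<rho>' > max \<rho> 1\<close> by auto
  qed (fact assms A B)+
  then interpret weakly_convex_problem X f g \<rho> \<rho>' M glb .
  have D_bound: "norm (y - c) \<le> D"
    if "optimal_solution X (prox_fun \<rho>' f c) (prox_fun \<rho>' g c) y" for y c
  proof -
    have "y \<in> X" "prox_fun \<rho>' g c y \<le> 0"
      using that unfolding optimal_solution_def is_arg_min_def by auto
    then show ?thesis unfolding D_eq by (intro real_le_rsqrt prox_feasible_near)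
  qed
  show ?thesis
  proof (intro conjI allI impI, goal_cases)
    case (1 \<tau> T x k)
    show ?case
    proof (rule conjunct2[OF pgssm_iterates_feasible[OF 1(3) D \<open>\<epsilon> > 0\<close> 1(1) D_eq 1(2)]])
      fix j y assume j: "j < k"
        and y: "optimal_solution X (prox_fun \<rho>' f (x j)) (prox_fun \<rho>' g (x j)) y"
      show "\<epsilon> < \<rho>' * norm (y - x j)"
        using near_prox_solution_FJ[OF y, of \<epsilon>] 1(4) j y by (meson less_imp_le not_le_imp_less)
    qed
  next
    case (2 \<sigma> B \<tau> T x k)
    have B0: "B \<ge> 0"
    proof -
      have "D \<ge> 0"
        unfolding D_eq using glb_le[OF D(1)] D(2) rho_less
        by (intro real_sqrt_ge_zero divide_nonneg_pos) auto
      then show ?thesis using 2(1) M_pos rho'_gt_1 unfolding 2(2) by simp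
    qed
    \<comment> \<open>The parameters are those of the first part for the accuracy \<open>\<epsilon> / (1 + B)\<close>.\<close>
    define \<delta> where "\<delta> = \<epsilon> / (1 + B)"
    have \<delta>: "\<delta> > 0" "\<epsilon>\<^sup>2 = (1 + B)\<^sup>2 * \<delta>\<^sup>2" "\<epsilon> = (1 + B) * \<delta>"
      using B0 \<open>\<epsilon> > 0\<close> by (auto simp: \<delta>_def power_mult_distrib[symmetric])
    have cancel: "b * (1 + B)\<^sup>2 * c / (m * \<epsilon>\<^sup>2) = b * c / (m * \<delta>\<^sup>2)" for b c m :: real
      unfolding \<delta>(2) using B0 by (simp add: field_simps)
    have \<tau>: "\<tau> = (\<rho>' - \<rho>) * \<delta>\<^sup>2 / (4 * \<rho>' * (2 * \<rho>' - \<rho>))"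
    proof -
      have "a * ((1 + B)\<^sup>2 * \<delta>\<^sup>2) / (4 * (1 + B)\<^sup>2 * b * c) = a * \<delta>\<^sup>2 / (4 * b * c)" for a b c :: real
        using B0 by (simp add: field_simps)
      then show ?thesis unfolding 2(3) \<delta>(2) .
    qed
    have T: "T = nat \<lceil>max
        (96 * \<rho>' * (2 * \<rho>' - \<rho>) * (3 * M\<^sup>2 - 2 * \<rho>' * glb) / ((\<rho>' - \<rho>)\<^sup>2 * \<delta>\<^sup>2))
        (sqrt (288 * \<rho>' ^ 3 * (2 * \<rho>' - \<rho>) * D\<^sup>2 / ((\<rho>' - \<rho>)\<^sup>2 * \<delta>\<^sup>2)))\<rceil>"
      unfolding 2(4) using cancel by (simp only: mult.assoc)
    show ?case
    proof (rule conjunct2[OF pgssm_iterates_feasible[OF 2(5) D \<delta>(1) \<tau> D_eq T]])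
      fix j y assume j: "j < k"
        and y: "optimal_solution X (prox_fun \<rho>' f (x j)) (prox_fun \<rho>' g (x j)) y"
      have "KKT_point \<epsilon> X f g y" if "\<rho>' * norm (y - x j) \<le> \<delta>"
      proof (rule near_prox_solution_KKT[OF y _ 2(1) D_bound[OF y] 2(2)])
        show "strong_MFCQ \<sigma> X (prox_fun \<rho>' g (x j))" using 2(6) by blast
        show "(1 + B) * (\<rho>' * norm (y - x j)) \<le> \<epsilon>"
          unfolding \<delta>(3) using that B0 by (intro mult_left_mono) auto
      qed
      then show "\<delta> < \<rho>' * norm (y - x j)"
        using 2(7) j y by (meson less_imp_le not_le_imp_less)
    qed
  qed
qed

end
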